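(* Let $G=\langle s_1,\dots,s_r\rangle$ be a free group or free semigroup (with identity) of rank $r$. A $G$-process $(T,X,\mu,\alpha)$ with $H(\alpha)<\infty$ is Markov if and only if $F(T,\alpha)=f(T,\alpha)$.
   Context: $G=\langle s_1,\dots,s_r\rangle$ is either a free group or a free semigroup with identity $e$ on $s_1,\dots,s_r$. Put $S=\{s_1^{\pm1},\dots,s_r^{\pm1}\}$ in the group case and $S=\{s_1,\dots,s_r\}$ in the semigroup case; $B(e,n)$ is the ball of radius $n$ about $e$ for the word metric of $S$. $G\curvearrowright^T(X,\mathcal B,\mu)$ means that $(X,\mathcal B,\mu)$ is a standard probability space and $g\mapsto T_g$ is a homomorphism from $G$ to the semigroup of measure-preserving transformations of $X$. A $G$-process is a quadruple $(T,X,\mu,\alpha)$ with $G\curvearrowright^T(X,\mathcal B,\mu)$ and $\alpha$ a measurable partition of $X$, finite or countably infinite. $H(\alpha)=-\sum_{A\in\alpha}\mu(A)\log\mu(A)$, $\alpha\vee\beta=\{A\cap B\}$, $\alpha^n=\bigvee_{g\in B(e,n)}T_g^{-1}\alpha$, and $$F(T,\alpha)=(1-2r)H(\alpha)+\sum_{i=1}^rH(\alpha\vee T_{s_i}^{-1}\alpha),\qquad f(T,\alpha)=\inf_{n>0}F(T,\alpha^n).$$ The left-Cayley graph $\Gamma_L$ has vertex set $G$ and an edge from $g$ to $sg$ for every $g\in G$, $s\in S$; paths in $\Gamma_L$ ignore edge directions. $\mathrm{Past}(g_1;g_2)$ is the set of $f\in G$ such that every path in $\Gamma_L$ from $f$ to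 $g_1$ passes through $g_2$. $(T,X,\mu,\alpha)$ is Markov if for every $s\in S$, $g\in G$, $A\in\alpha$, $$\mu\Big(T_{sg}^{-1}A\,\Big|\bigvee_{f\in\mathrm{Past}(sg;g)}T_f^{-1}\alpha\Big)=\mu(T_{sg}^{-1}A\,|\,T_g^{-1}\alpha)\quad\mu\text{-a.e.},$$ where $\mu(\cdot|\mathcal F)$ is conditional expectation of the characteristic function and joins of partitions are identified with the $\sigma$-algebras they generate. *)

theory Defs
  imports "HOL-Probability.Probability" "HOL-Algebra.Generated_Groups"
begin

section \<open>Free groups and free semigroups with identity\<close>

definition word_prod :: "('g, 'b) monoid_scheme \<Rightarrow> 'g list \<Rightarrow> 'g" where
  "word_prod G w = foldr (\<otimes>\<^bsub>G\<^esub>) w \<one>\<^bsub>G\<^esub>"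

text \<open>A letter is a pair of a generator index and a sign; \<open>True\<close> stands for the exponent +1.\<close>

definition letter :: "('g, 'b) monoid_scheme \<Rightarrow> (nat \<Rightarrow> 'g) \<Rightarrow> nat \<times> bool \<Rightarrow> 'g" where
  "letter G s l = (if snd l then s (fst l) else inv\<^bsub>G\<^esub> (s (fst l)))"

definition reduced :: "(nat \<times> bool) list \<Rightarrow> bool" where
  "reduced w \<longleftrightarrow> successively (\<lambda>k l. \<not> (fst k = fst l \<and> snd k \<noteq> snd l)) w"

definition free_group_on :: "('g, 'b) monoid_scheme \<Rightarrow> nat \<Rightarrow> (nat \<Rightarrow> 'g) \<Rightarrow> bool" where
  "free_group_on G r s \<longleftrightarrow>
     group G \<and> s \<in> {..<r} \<rightarrow> carrier G \<and> generate G (s ` {..<r}) = carrier G \<and>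
     (\<forall>w \<in> lists ({..<r} \<times> UNIV).
        reduced w \<and> w \<noteq> [] \<longrightarrow> word_prod G (map (letter G s) w) \<noteq> \<one>\<^bsub>G\<^esub>)"

definition free_semigroup_on :: "('g, 'b) monoid_scheme \<Rightarrow> nat \<Rightarrow> (nat \<Rightarrow> 'g) \<Rightarrow> bool" where
  "free_semigroup_on G r s \<longleftrightarrow>
     monoid G \<and> s \<in> {..<r} \<rightarrow> carrier G \<and>
     bij_betw (\<lambda>w. word_prod G (map s w)) (lists {..<r}) (carrier G)"

section \<open>Word metric and left-Cayley graph\<close>

text \<open>In the group case these are used with \<open>S\<close> closed under inverses, so words over \<open>S\<close>
  exhaust \<open>G\<close> in both cases.\<close>

definition word_length :: "('g, 'b) monoid_scheme \<Rightarrow> 'g set \<Rightarrow> 'g \<Rightarrow> nat" where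
  "word_length G S g = (LEAST n. \<exists>w \<in> lists S. length w = n \<and> word_prod G w = g)"

definition word_ball :: "('g, 'b) monoid_scheme \<Rightarrow> 'g set \<Rightarrow> nat \<Rightarrow> 'g set" where
  "word_ball G S n = {g \<in> carrier G. word_length G S g \<le> n}"

definition left_cayley_edge :: "('g, 'b) monoid_scheme \<Rightarrow> 'g set \<Rightarrow> 'g \<Rightarrow> 'g \<Rightarrow> bool" where
  "left_cayley_edge G S g h \<longleftrightarrow> g \<in> carrier G \<and> (\<exists>s \<in> S. h = s \<otimes>\<^bsub>G\<^esub> g)"

definition cayley_path ::
  "('g, 'b) monoid_scheme \<Rightarrow> 'g set \<Rightarrow> 'g \<Rightarrow> 'g list \<Rightarrow> 'g \<Rightarrow> bool" where
  "cayley_path G S g p h \<longleftrightarrow>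
     p \<noteq> [] \<and> set p \<subseteq> carrier G \<and> hd p = g \<and> last p = h \<and>
     successively (\<lambda>u v. left_cayley_edge G S u v \<or> left_cayley_edge G S v u) p"

definition Past :: "('g, 'b) monoid_scheme \<Rightarrow> 'g set \<Rightarrow> 'g \<Rightarrow> 'g \<Rightarrow> 'g set" where
  "Past G S g1 g2 = {f \<in> carrier G. \<forall>p. cayley_path G S f p g1 \<longrightarrow> g2 \<in> set p}"

section \<open>Processes\<close>

text \<open>A standard probability space is a probability measure on the Borel \<open>\<sigma>\<close>-algebra of
  some Polish topology on the underlying set.\<close>

definition standard_prob_space :: "'x measure \<Rightarrow> bool" where
  "standard_prob_space M \<longleftrightarrow>
     prob_space M \<and>
     (\<exists>\<tau>. completely_metrizable_space \<tau> \<and> separable_space \<tau> \<and> topspace \<tau> = space M \<and>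
          sets M = sigma_sets (space M) {U. openin \<tau> U})"

definition measure_preserving_map :: "'x measure \<Rightarrow> ('x \<Rightarrow> 'x) \<Rightarrow> bool" where
  "measure_preserving_map M f \<longleftrightarrow> f \<in> measurable M M \<and> distr M M f = M"

definition pmp_action ::
  "('g, 'b) monoid_scheme \<Rightarrow> 'x measure \<Rightarrow> ('g \<Rightarrow> 'x \<Rightarrow> 'x) \<Rightarrow> bool" where
  "pmp_action G M T \<longleftrightarrow>
     standard_prob_space M \<and>
     (\<forall>g \<in> carrier G. measure_preserving_map M (T g)) \<and>
     (\<forall>x \<in> space M. T \<one>\<^bsub>G\<^esub> x = x) \<and>
     (\<forall>g \<in> carrier G. \<forall>h \<in> carrier G. \<forall>x \<in> space M. T (g \<otimes>\<^bsub>G\<^esub> h) x = T g (T h x))"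

definition G_process ::
  "('g, 'b) monoid_scheme \<Rightarrow> ('g \<Rightarrow> 'x \<Rightarrow> 'x) \<Rightarrow> 'x measure \<Rightarrow> 'x set set \<Rightarrow> bool" where
  "G_process G T M \<alpha> \<longleftrightarrow>
     pmp_action G M T \<and> partition_on (space M) \<alpha> \<and> \<alpha> \<subseteq> sets M \<and> countable \<alpha>"

definition pullback :: "'x measure \<Rightarrow> ('x \<Rightarrow> 'x) \<Rightarrow> 'x set set \<Rightarrow> 'x set set" where
  "pullback M f \<alpha> = (\<lambda>A. f -` A \<inter> space M) ` \<alpha>"

section \<open>Entropy and the invariant f\<close>

text \<open>Finite joins of partitions are rendered by \<^const>\<open>common_refinement\<close>, which omits empty
  intersections; these contribute nothing to the entropy, as \<open>ln 0 = 0\<close>.\<close>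

definition partition_entropy :: "'x measure \<Rightarrow> 'x set set \<Rightarrow> ennreal" where
  "partition_entropy M \<alpha> = (\<Sum>\<^sub>\<infinity>A\<in>\<alpha>. ennreal (- (measure M A * ln (measure M A))))"

definition ball_join ::
  "('g, 'b) monoid_scheme \<Rightarrow> 'g set \<Rightarrow> ('g \<Rightarrow> 'x \<Rightarrow> 'x) \<Rightarrow> 'x measure \<Rightarrow> 'x set set \<Rightarrow> nat \<Rightarrow> 'x set set"
  where
  "ball_join G S T M \<alpha> n = common_refinement ((\<lambda>g. pullback M (T g) \<alpha>) ` word_ball G S n)"

text \<open>The values are extended reals because the infimum defining \<open>f_invariant\<close> can be
  \<open>-\<infinity>\<close>. \<open>F_functional\<close> is meaningful only for partitions of finite entropy; for others
  it may involve \<open>\<infinity> - \<infinity>\<close>.\<close>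

definition F_functional ::
  "nat \<Rightarrow> (nat \<Rightarrow> 'g) \<Rightarrow> ('g \<Rightarrow> 'x \<Rightarrow> 'x) \<Rightarrow> 'x measure \<Rightarrow> 'x set set \<Rightarrow> ereal" where
  "F_functional r s T M \<alpha> =
     ereal (1 - 2 * real r) * enn2ereal (partition_entropy M \<alpha>) +
     (\<Sum>i<r. enn2ereal (partition_entropy M (common_refinement {\<alpha>, pullback M (T (s i)) \<alpha>})))"

definition f_invariant ::
  "('g, 'b) monoid_scheme \<Rightarrow> nat \<Rightarrow> (nat \<Rightarrow> 'g) \<Rightarrow> 'g set \<Rightarrow> ('g \<Rightarrow> 'x \<Rightarrow> 'x) \<Rightarrow> 'x measure \<Rightarrow>
     'x set set \<Rightarrow> ereal" where
  "f_invariant G r s S T M \<alpha> = (INF n\<in>{0<..}. F_functional r s T M (ball_join G S T M \<alpha> n))"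

section \<open>Markov processes\<close>

definition join_algebra ::
  "('g \<Rightarrow> 'x \<Rightarrow> 'x) \<Rightarrow> 'x measure \<Rightarrow> 'x set set \<Rightarrow> 'g set \<Rightarrow> 'x measure" where
  "join_algebra T M \<alpha> Q = sigma (space M) (\<Union>f\<in>Q. pullback M (T f) \<alpha>)"

definition cond_prob_algebra :: "'x measure \<Rightarrow> 'x set \<Rightarrow> 'x measure \<Rightarrow> 'x \<Rightarrow> real" where
  "cond_prob_algebra M B \<F> = real_cond_exp M \<F> (indicator B)"

definition Markov_process ::
  "('g, 'b) monoid_scheme \<Rightarrow> 'g set \<Rightarrow> ('g \<Rightarrow> 'x \<Rightarrow> 'x) \<Rightarrow> 'x measure \<Rightarrow> 'x set set \<Rightarrow> bool" where
  "Markov_process G S T M \<alpha> \<longleftrightarrow>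
     (\<forall>t \<in> S. \<forall>g \<in> carrier G. \<forall>A \<in> \<alpha>.
        let B = T (t \<otimes>\<^bsub>G\<^esub> g) -` A \<inter> space M in
        AE x in M.
          cond_prob_algebra M B (join_algebra T M \<alpha> (Past G S (t \<otimes>\<^bsub>G\<^esub> g) g)) x =
          cond_prob_algebra M B (join_algebra T M \<alpha> {g}) x)"

end

theory Submission
  imports Defs "HOL-Library.Sublist"
begin

text \<open>Name each element of \<open>G\<close> by its reduced word. The left Cayley graph is then a tree: the parent
of a nonempty word is its tail, and multiplying by a generator on the left moves along an edge.
For a finite set \<open>K\<close> of group elements let \<open>H K\<close> be the entropy of the joint label
\<open>x \<mapsto> (the cell of T g x)\<close>, \<open>g \<in> K\<close>. Two properties of \<open>H\<close> carry the whole argument: strong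
subadditivity \<open>H (K \<union> L) + H C \<le> H K + H L\<close> for \<open>C \<subseteq> K \<inter> L\<close>, and invariance
\<open>H (K g) = H K\<close> under right translation, which holds because the action preserves the measure.

Attaching a leaf \<open>s g\<close> to a subtree that contains \<open>g\<close> raises the entropy by at most
\<open>H {e, s} - H {e}\<close>. Adding these bounds over the vertices of a finite subtree gives
\<open>H K \<le> \<Phi> K\<close>, where \<open>\<Phi>\<close> is a sum of weights that depend only on the first letter of a word.
The proof compares both sides of the theorem with the single condition that \<open>H = \<Phi>\<close> on all finite
subtrees (\<open>tree_additive\<close>).

The Markov property is equivalent to this condition (\<open>Markov_iff_tree_additive\<close>). Equality in strong
subadditivity is conditional independence (\<open>rv_entropy_eq_iff_cond_indep\<close>), so the Markov condition
at an edge says exactly that adding the new vertex to a finite part of the past gains as much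
entropy as adding it to its neighbour alone (\<open>cond_prob_eq_iff_entropy\<close>). For an edge that leads
from a word to its child, the past consists of the words that do not descend from the child
(\<open>Past_parent\<close>); an edge that leads to the parent occurs only in a group, where right
translation moves it to an edge starting at the identity.

The equation \<open>F = f\<close> is also equivalent to it. Counting words shows that \<open>F (\<alpha>^n)\<close> would not depend
on \<open>n\<close> if \<open>H\<close> were replaced by \<open>\<Phi>\<close> (\<open>tree_sum_identity\<close>); hence additivity implies that all
\<open>F (\<alpha>^n)\<close> equal \<open>F (\<alpha>)\<close>. Conversely, suppose that \<open>F (\<alpha>) \<le> F (\<alpha>^n)\<close> for all \<open>n\<close>. Strong
subadditivity for the ball of radius \<open>n + 1\<close> and its translates bounds \<open>F (\<alpha>^(n+1))\<close> from above
in terms of the entropies of that ball and of smaller sets, so the assumption bounds the entropy of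
the ball from below. When the ball of radius \<open>n\<close> already attains the bound \<open>\<Phi>\<close>, this lower bound is again \<open>\<Phi>\<close>
(\<open>ball_additive_Suc\<close>). So every ball attains it, and a subtree of a tree that attains the bound
attains it as well.\<close>

section \<open>Entropy of discrete distributions\<close>

text \<open>The entropy is written as the mean of the information \<open>- ln p\<close>, so that entropies of images of \<open>p\<close>
become integrals over one and the same distribution.\<close>

definition pmf_entropy :: "'a pmf \<Rightarrow> ennreal" where
  "pmf_entropy p = (\<integral>\<^sup>+x. ennreal (- ln (pmf p x)) \<partial>measure_pmf p)"

lemma pmf_entropy_map:
  "pmf_entropy (map_pmf f p) = (\<integral>\<^sup>+x. ennreal (- ln (pmf (map_pmf f p) (f x))) \<partial>measure_pmf p)"
  by (simp add: pmf_entropy_def)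

text \<open>The pointwise form of Gibbs' inequality, from \<open>ln x \<le> x - 1\<close> at \<open>x = Q / P\<close>. Nothing is
subtracted, so for probabilities both sides are nonnegative and can be integrated in \<open>ennreal\<close>
whether or not the entropies are finite.\<close>

lemma Gibbs_pointwise:
  fixes P Q :: real
  assumes "0 \<le> P" "0 \<le> Q" "0 < P \<Longrightarrow> 0 < Q"
  shows "P * - ln P + P \<le> P * - ln Q + Q"
    and "P * - ln P + P = P * - ln Q + Q \<longleftrightarrow> P = Q"
proof -
  have *: "P * - ln P + P \<le> P * - ln Q + Q \<and> (P * - ln P + P = P * - ln Q + Q \<longleftrightarrow> P = Q)"
  proof (cases "P = 0")
    case False
    then have P: "0 < P" and Q: "0 < Q" using assms by auto
    define x where "x = Q / P"
    have x: "0 < x" and Qx: "Q = P * x" using P Q by (auto simp: x_def)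
    have l: "ln Q = ln P + ln x" using P x by (simp add: Qx ln_mult)
    have "(P * - ln Q + Q) - (P * - ln P + P) = P * (x - 1 - ln x)"
      unfolding l by (simp add: Qx algebra_simps)
    moreover have "ln x \<le> x - 1" using x by (rule ln_le_minus_one)
    moreover have "ln x = x - 1 \<longleftrightarrow> x = 1" using x ln_eq_minus_one by auto
    moreover have "x = 1 \<longleftrightarrow> P = Q" using P by (auto simp: x_def field_simps)
    ultimately show ?thesis using P by (smt (verit) mult_eq_0_iff mult_nonneg_nonneg)
  qed (use assms in auto)
  show "P * - ln P + P \<le> P * - ln Q + Q"
    and "P * - ln P + P = P * - ln Q + Q \<longleftrightarrow> P = Q" using * by auto
qed

lemma ln_pmf_nonpos: "ln (pmf p x) \<le> 0"
  using pmf_le_1[of p x] pmf_nonneg[of p x] by (cases "pmf p x = 0") (auto simp: less_le)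

text \<open>The density of the coupling of the two marginals of \<open>p\<close> that makes them conditionally independent
given the common value \<open>u (fst x) = v (snd x)\<close>.\<close>

definition cond_indep_density :: "('a \<times> 'b) pmf \<Rightarrow> ('a \<Rightarrow> 'c) \<Rightarrow> ('b \<Rightarrow> 'c) \<Rightarrow> 'a \<times> 'b \<Rightarrow> real" where
  "cond_indep_density p u v x = (if u (fst x) = v (snd x)
     then pmf (map_pmf fst p) (fst x) * pmf (map_pmf snd p) (snd x) /
          pmf (map_pmf (\<lambda>x. u (fst x)) p) (u (fst x)) else 0)"

lemma cond_indep_density_nonneg: "0 \<le> cond_indep_density p u v x"
  by (simp add: cond_indep_density_def)

lemma pmf_map_pos: "0 < pmf p x \<Longrightarrow> 0 < pmf (map_pmf f p) (f x)"
  by (metis imageI pmf_positive_iff set_map_pmf)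

text \<open>For a fixed first coordinate \<open>a\<close> the second coordinates with \<open>v b = u a\<close> have total mass
equal to the denominator, so integrating out \<open>b\<close> leaves the mass of \<open>a\<close>.\<close>

lemma nn_integral_cond_indep_density_le_1:
  assumes uv: "\<And>a b. (a, b) \<in> set_pmf p \<Longrightarrow> u a = v b"
  shows "(\<integral>\<^sup>+x. ennreal (cond_indep_density p u v x) \<partial>count_space UNIV) \<le> 1"
proof -
  let ?pa = "map_pmf fst p" and ?pb = "map_pmf snd p" and ?pc = "map_pmf (\<lambda>x. u (fst x)) p"
  have pc: "?pc = map_pmf v ?pb"
    by (auto simp: pmf.map_comp o_def intro!: map_pmf_cong dest: uv)
  have "(\<integral>\<^sup>+b. ennreal (cond_indep_density p u v (a, b)) \<partial>count_space UNIV) \<le> ennreal (pmf ?pa a)" for a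
  proof -
    have "(\<integral>\<^sup>+b. ennreal (cond_indep_density p u v (a, b)) \<partial>count_space UNIV) =
        (\<integral>\<^sup>+b. ennreal (pmf ?pa a / pmf ?pc (u a)) *
               (ennreal (pmf ?pb b) * indicator {b. v b = u a} b) \<partial>count_space UNIV)"
      by (intro nn_integral_cong) (auto simp: cond_indep_density_def ennreal_mult[symmetric] split: split_indicator)
    also have "\<dots> = ennreal (pmf ?pa a / pmf ?pc (u a)) *
        (\<integral>\<^sup>+b. indicator {b. v b = u a} b \<partial>measure_pmf ?pb)"
      by (subst nn_integral_measure_pmf) (simp add: nn_integral_cmult)
    also have "(\<integral>\<^sup>+b. indicator {b. v b = u a} b \<partial>measure_pmf ?pb) = ennreal (pmf ?pc (u a))"
      unfolding pc by (simp add: nn_integral_indicator ennreal_pmf_map vimage_def)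
    also have "ennreal (pmf ?pa a / pmf ?pc (u a)) * ennreal (pmf ?pc (u a)) \<le> ennreal (pmf ?pa a)"
      by (simp add: ennreal_mult[symmetric])
    finally show ?thesis .
  qed
  then have "(\<integral>\<^sup>+a. \<integral>\<^sup>+b. ennreal (cond_indep_density p u v (a, b)) \<partial>count_space UNIV \<partial>count_space UNIV)
      \<le> (\<integral>\<^sup>+a. ennreal (pmf ?pa a) \<partial>count_space UNIV)"
    by (intro nn_integral_mono) auto
  also have "\<dots> = 1" by (simp add: nn_integral_pmf)
  finally show ?thesis
    using nn_integral_fst_count_space[of "\<lambda>x. ennreal (cond_indep_density p u v x)"] by simp
qed

text \<open>Gibbs' inequality for \<open>p\<close> against the conditionally independent coupling, with the total masses \<open>1\<close>
of \<open>p\<close> and of the coupling left on the two sides. The comparison functions are returned so that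
both the inequality and its equality case can be read off.\<close>

lemma pmf_entropy_Gibbs_comparison:
  fixes p :: "('a \<times> 'b) pmf"
  assumes uv: "\<And>a b. (a, b) \<in> set_pmf p \<Longrightarrow> u a = v b"
  obtains L R where
    "\<And>x. 0 \<le> L x" "\<And>x. L x \<le> R x" "\<And>x. L x = R x \<longleftrightarrow> pmf p x = cond_indep_density p u v x"
    "(\<integral>\<^sup>+x. ennreal (L x) \<partial>count_space UNIV) =
       pmf_entropy p + pmf_entropy (map_pmf (\<lambda>x. u (fst x)) p) + 1"
    "(\<integral>\<^sup>+x. ennreal (R x) \<partial>count_space UNIV) =
       pmf_entropy (map_pmf fst p) + pmf_entropy (map_pmf snd p) +
       (\<integral>\<^sup>+x. ennreal (cond_indep_density p u v x) \<partial>count_space UNIV)"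
proof -
  let ?pa = "map_pmf fst p" and ?pb = "map_pmf snd p" and ?pc = "map_pmf (\<lambda>x. u (fst x)) p"
  define L where "L x = pmf p x * - ln (pmf p x) + pmf p x * - ln (pmf ?pc (u (fst x))) + pmf p x" for x
  define R where "R x = pmf p x * - ln (pmf ?pa (fst x)) + pmf p x * - ln (pmf ?pb (snd x))
     + cond_indep_density p u v x" for x
  have LR: "L x \<le> R x \<and> (L x = R x \<longleftrightarrow> pmf p x = cond_indep_density p u v x)" for x
  proof (cases "pmf p x = 0")
    case False
    then have P: "0 < pmf p x" by (simp add: less_le)
    have pos: "0 < pmf ?pa (fst x)" "0 < pmf ?pb (snd x)" "0 < pmf ?pc (u (fst x))"
      using pmf_map_pos[OF P, of fst] pmf_map_pos[OF P, of snd] pmf_map_pos[OF P, of "\<lambda>x. u (fst x)"]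
      by auto
    have "u (fst x) = v (snd x)" using P uv[of "fst x" "snd x"] by (simp add: pmf_positive_iff)
    then have g: "cond_indep_density p u v x = pmf ?pa (fst x) * pmf ?pb (snd x) / pmf ?pc (u (fst x))"
      by (simp add: cond_indep_density_def)
    have gpos: "0 < cond_indep_density p u v x" unfolding g using pos by simp
    have l: "ln (cond_indep_density p u v x) = ln (pmf ?pa (fst x)) + ln (pmf ?pb (snd x)) - ln (pmf ?pc (u (fst x)))"
      unfolding g using pos by (simp add: ln_mult ln_div)
    have Leq: "L x = (pmf p x * - ln (pmf p x) + pmf p x) - pmf p x * ln (pmf ?pc (u (fst x)))"
      by (simp add: L_def)
    have Req: "R x = (pmf p x * - ln (cond_indep_density p u v x) + cond_indep_density p u v x) - pmf p x * ln (pmf ?pc (u (fst x)))"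
      unfolding R_def l by (simp add: algebra_simps)
    show ?thesis
      using Gibbs_pointwise[of "pmf p x" "cond_indep_density p u v x"] gpos
      unfolding Leq Req by auto
  qed (auto simp: L_def R_def cond_indep_density_nonneg)
  have 1: "(\<integral>\<^sup>+x. ennreal (pmf p x * - ln (f x)) \<partial>count_space UNIV) =
      (\<integral>\<^sup>+x. ennreal (- ln (f x)) \<partial>measure_pmf p)" for f :: "'a \<times> 'b \<Rightarrow> real"
    unfolding nn_integral_measure_pmf by (intro nn_integral_cong) (rule ennreal_mult', simp)
  have nn: "0 \<le> pmf p x * - ln (pmf q y)" for x y and q :: "'d pmf"
    using ln_pmf_nonpos[of q y] by (simp add: mult_nonneg_nonpos)
  have "(\<integral>\<^sup>+x. ennreal (L x) \<partial>count_space UNIV) =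
     (\<integral>\<^sup>+x. ennreal (pmf p x * - ln (pmf p x)) + ennreal (pmf p x * - ln (pmf ?pc (u (fst x))))
            + ennreal (pmf p x) \<partial>count_space UNIV)"
    unfolding L_def by (intro nn_integral_cong)
      (simp only: ennreal_plus add_nonneg_nonneg nn pmf_nonneg)
  also have "\<dots> = pmf_entropy p + pmf_entropy ?pc + 1"
    by (subst nn_integral_add, simp, simp)+
      (simp only: 1 pmf_entropy_map pmf_entropy_def[of p] nn_integral_pmf, simp)
  finally have intL: "(\<integral>\<^sup>+x. ennreal (L x) \<partial>count_space UNIV) = pmf_entropy p + pmf_entropy ?pc + 1" .
  have "(\<integral>\<^sup>+x. ennreal (R x) \<partial>count_space UNIV) =
     (\<integral>\<^sup>+x. ennreal (pmf p x * - ln (pmf ?pa (fst x))) + ennreal (pmf p x * - ln (pmf ?pb (snd x)))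
            + ennreal (cond_indep_density p u v x) \<partial>count_space UNIV)"
    unfolding R_def by (intro nn_integral_cong)
      (simp only: ennreal_plus add_nonneg_nonneg nn cond_indep_density_nonneg)
  also have "\<dots> = pmf_entropy ?pa + pmf_entropy ?pb + (\<integral>\<^sup>+x. ennreal (cond_indep_density p u v x) \<partial>count_space UNIV)"
    by (subst nn_integral_add, simp, simp)+ (simp only: 1 pmf_entropy_map)
  finally have intR: "(\<integral>\<^sup>+x. ennreal (R x) \<partial>count_space UNIV) =
     pmf_entropy ?pa + pmf_entropy ?pb + (\<integral>\<^sup>+x. ennreal (cond_indep_density p u v x) \<partial>count_space UNIV)" .
  have "0 \<le> L x" for x
    unfolding L_def by (intro add_nonneg_nonneg nn pmf_nonneg)
  with LR intL intR show ?thesis by (intro that[of L R]) auto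
qed

lemma pmf_entropy_strong_subadditive:
  fixes p :: "('a \<times> 'b) pmf"
  assumes uv: "\<And>a b. (a, b) \<in> set_pmf p \<Longrightarrow> u a = v b"
  shows "pmf_entropy p + pmf_entropy (map_pmf (\<lambda>x. u (fst x)) p)
     \<le> pmf_entropy (map_pmf fst p) + pmf_entropy (map_pmf snd p)"
proof -
  obtain L R where *: "\<And>x. 0 \<le> L x" "\<And>x. L x \<le> R x" "\<And>x. L x = R x \<longleftrightarrow> pmf p x = cond_indep_density p u v x"
    "(\<integral>\<^sup>+x. ennreal (L x) \<partial>count_space UNIV) =
       pmf_entropy p + pmf_entropy (map_pmf (\<lambda>x. u (fst x)) p) + 1"
    "(\<integral>\<^sup>+x. ennreal (R x) \<partial>count_space UNIV) =
       pmf_entropy (map_pmf fst p) + pmf_entropy (map_pmf snd p) +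
       (\<integral>\<^sup>+x. ennreal (cond_indep_density p u v x) \<partial>count_space UNIV)"
    by (rule pmf_entropy_Gibbs_comparison[of p u v, OF uv]) blast+
  have "(\<integral>\<^sup>+x. ennreal (L x) \<partial>count_space UNIV) \<le> (\<integral>\<^sup>+x. ennreal (R x) \<partial>count_space UNIV)"
    using *(2) by (intro nn_integral_mono) (simp add: ennreal_leI)
  also have "\<dots> \<le> pmf_entropy (map_pmf fst p) + pmf_entropy (map_pmf snd p) + 1"
    unfolding *(5) using nn_integral_cond_indep_density_le_1[of p u v] uv by (intro add_left_mono) auto
  finally show ?thesis
    unfolding *(4) by (subst (asm) (1 2) add.commute) (simp add: ennreal_add_left_cancel_le)
qed

text \<open>A pointwise inequality between functions with the same finite integral is an equality everywhere
for counting measure; on the points of mass zero this says that the coupling has no mass there either.\<close>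

lemma pmf_entropy_strong_subadditive_eq_iff:
  fixes p :: "('a \<times> 'b) pmf"
  assumes uv: "\<And>a b. (a, b) \<in> set_pmf p \<Longrightarrow> u a = v b"
    and fin: "pmf_entropy (map_pmf fst p) < \<infinity>" "pmf_entropy (map_pmf snd p) < \<infinity>"
  shows "pmf_entropy p + pmf_entropy (map_pmf (\<lambda>x. u (fst x)) p)
       = pmf_entropy (map_pmf fst p) + pmf_entropy (map_pmf snd p)
     \<longleftrightarrow> (\<forall>x. pmf p x = cond_indep_density p u v x)" (is "?H = ?H' \<longleftrightarrow> _")
proof -
  obtain L R where *: "\<And>x. 0 \<le> L x" "\<And>x. L x \<le> R x" "\<And>x. L x = R x \<longleftrightarrow> pmf p x = cond_indep_density p u v x"
    "(\<integral>\<^sup>+x. ennreal (L x) \<partial>count_space UNIV) = ?H + 1"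
    "(\<integral>\<^sup>+x. ennreal (R x) \<partial>count_space UNIV) =
       ?H' + (\<integral>\<^sup>+x. ennreal (cond_indep_density p u v x) \<partial>count_space UNIV)"
    by (rule pmf_entropy_Gibbs_comparison[of p u v, OF uv]) blast+
  show ?thesis
  proof
    assume eq: "?H = ?H'"
    have fin': "?H < \<infinity>" unfolding eq using fin by simp
    have RL: "(\<integral>\<^sup>+x. ennreal (R x) \<partial>count_space UNIV) \<le> (\<integral>\<^sup>+x. ennreal (L x) \<partial>count_space UNIV)"
      unfolding *(4,5) eq using nn_integral_cond_indep_density_le_1[of p u v] uv by (intro add_left_mono) auto
    have "R x \<le> L x" for x
    proof (rule ccontr)
      assume "\<not> R x \<le> L x"
      then have "\<not> ennreal (R x) \<le> ennreal (L x)" using *(1)[of x] by (simp add: ennreal_le_iff)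
      then have "\<not> (AE x in count_space UNIV. ennreal (R x) \<le> ennreal (L x))"
        by (subst AE_count_space) blast
      then have "(\<integral>\<^sup>+x. ennreal (L x) \<partial>count_space UNIV) < (\<integral>\<^sup>+x. ennreal (R x) \<partial>count_space UNIV)"
        using *(2) fin' by (intro nn_integral_less) (auto simp: *(4) ennreal_leI)
      with RL show False by simp
    qed
    with * show "\<forall>x. pmf p x = cond_indep_density p u v x" by (metis order_antisym)
  next
    assume density: "\<forall>x. pmf p x = cond_indep_density p u v x"
    then have "L = R" using *(3) by auto
    moreover have "(\<integral>\<^sup>+x. ennreal (cond_indep_density p u v x) \<partial>count_space UNIV) = 1"
      using density by (simp add: nn_integral_pmf flip: density[rule_format])
    ultimately have "?H + 1 = ?H' + 1" using *(4,5) by metis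
    then show "?H = ?H'"
      by (subst (asm) (1 2) add.commute) (simp add: ennreal_add_left_cancel)
  qed
qed

section \<open>Entropy of discrete random variables\<close>

lemma nn_integral_count_space_eq_infsum:
  fixes f :: "'a \<Rightarrow> ennreal"
  assumes "countable A"
  shows "(\<integral>\<^sup>+x. f x \<partial>count_space A) = (\<Sum>\<^sub>\<infinity>x\<in>A. f x)"
proof (cases "finite A")
  case False
  have bij: "bij_betw (from_nat_into A) UNIV A"
    using assms False by (rule bij_betw_from_nat_into)
  have "(\<integral>\<^sup>+x. f x \<partial>count_space A) = (\<integral>\<^sup>+n. f (from_nat_into A n) \<partial>count_space UNIV)"
    by (rule nn_integral_bij_count_space[OF bij, symmetric])
  also have "\<dots> = (\<Sum>n. f (from_nat_into A n))" by (rule nn_integral_count_space_nat)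
  also have "\<dots> = (\<Sum>\<^sub>\<infinity>n. f (from_nat_into A n))"
    by (intro sums_unique[symmetric] has_sum_imp_sums has_sum_infsum nonneg_summable_on_complete) simp
  also have "\<dots> = (\<Sum>\<^sub>\<infinity>x\<in>A. f x)" by (rule infsum_reindex_bij_betw[OF bij])
  finally show ?thesis .
qed (simp add: nn_integral_count_space_finite)

definition discrete_rv :: "'x measure \<Rightarrow> ('x \<Rightarrow> 'c) \<Rightarrow> bool" where
  "discrete_rv M Y \<longleftrightarrow> Y \<in> measurable M (count_space UNIV) \<and> countable (Y ` space M)"

definition law :: "'x measure \<Rightarrow> ('x \<Rightarrow> 'c) \<Rightarrow> 'c pmf" where
  "law M Y = Abs_pmf (distr M (count_space UNIV) Y)"

definition rv_entropy :: "'x measure \<Rightarrow> ('x \<Rightarrow> 'c) \<Rightarrow> ennreal" where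
  "rv_entropy M Y = pmf_entropy (law M Y)"

text \<open>A partition enters only through its entropy and its joins. Writing it as the level sets of a random
variable turns joins into tuples of variables and pullbacks into compositions.\<close>

definition level_sets :: "'x measure \<Rightarrow> ('x \<Rightarrow> 'c) \<Rightarrow> 'x set set" where
  "level_sets M Y = (\<lambda>x. {y \<in> space M. Y y = Y x}) ` space M"

lemma discrete_rvI:
  assumes "countable (Y ` space M)" "\<And>c. c \<in> Y ` space M \<Longrightarrow> {x \<in> space M. Y x = c} \<in> sets M"
  shows "discrete_rv M Y"
proof -
  have "Y -` B \<inter> space M \<in> sets M" for B
  proof -
    have "Y -` B \<inter> space M = (\<Union>c \<in> B \<inter> Y ` space M. {x \<in> space M. Y x = c})" by auto
    moreover have "(\<Union>c \<in> B \<inter> Y ` space M. {x \<in> space M. Y x = c}) \<in> sets M"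
      using assms by (intro sets.countable_UN'') auto
    ultimately show ?thesis by simp
  qed
  then show ?thesis using assms by (auto simp: discrete_rv_def measurable_def)
qed

lemma discrete_rv_sets:
  assumes "discrete_rv M Y"
  shows "{x \<in> space M. Y x = c} \<in> sets M"
proof -
  have Y: "Y \<in> measurable M (count_space UNIV)"
    using assms unfolding discrete_rv_def by (rule conjunct1)
  have "Y -` {c} \<inter> space M \<in> sets M"
    by (rule measurable_sets[OF Y]) (simp only: sets_count_space Pow_UNIV UNIV_I)
  also have "Y -` {c} \<inter> space M = {x \<in> space M. Y x = c}" by blast
  finally show ?thesis .
qed

lemma discrete_rv_comp:
  assumes "discrete_rv M Y"
  shows "discrete_rv M (\<lambda>x. f (Y x))"
  unfolding discrete_rv_def
proof
  show "(\<lambda>x. f (Y x)) \<in> measurable M (count_space UNIV)"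
    using assms unfolding discrete_rv_def
    by (intro measurable_compose[of Y M "count_space UNIV" f]) simp_all
  have "countable (Y ` space M)" using assms unfolding discrete_rv_def ..
  then have "countable (f ` Y ` space M)" by (rule countable_image)
  then show "countable ((\<lambda>x. f (Y x)) ` space M)" by (simp only: image_image)
qed

lemma discrete_rv_Pair:
  assumes "discrete_rv M Y" "discrete_rv M Z"
  shows "discrete_rv M (\<lambda>x. (Y x, Z x))"
proof (rule discrete_rvI)
  have "(\<lambda>x. (Y x, Z x)) ` space M \<subseteq> Y ` space M \<times> Z ` space M" by auto
  moreover have "countable (Y ` space M \<times> Z ` space M)"
    using assms by (intro countable_SIGMA) (simp_all add: discrete_rv_def)
  ultimately show "countable ((\<lambda>x. (Y x, Z x)) ` space M)" by (rule countable_subset)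
  fix c
  have "{x \<in> space M. (Y x, Z x) = c} = {x \<in> space M. Y x = fst c} \<inter> {x \<in> space M. Z x = snd c}"
    by auto
  then show "{x \<in> space M. (Y x, Z x) = c} \<in> sets M"
    using discrete_rv_sets[OF assms(1), of "fst c"] discrete_rv_sets[OF assms(2), of "snd c"]
    by (simp only: sets.Int)
qed

lemma discrete_rv_restrict:
  assumes "finite I" "\<And>i. i \<in> I \<Longrightarrow> discrete_rv M (Y i)"
  shows "discrete_rv M (\<lambda>x. \<lambda>i\<in>I. Y i x)"
proof (rule discrete_rvI)
  have "(\<lambda>x. \<lambda>i\<in>I. Y i x) ` space M \<subseteq> (\<Pi>\<^sub>E i\<in>I. Y i ` space M)" by auto
  moreover have "countable (\<Pi>\<^sub>E i\<in>I. Y i ` space M)"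
    using assms by (intro countable_PiE) (auto simp: discrete_rv_def)
  ultimately show "countable ((\<lambda>x. \<lambda>i\<in>I. Y i x) ` space M)" by (rule countable_subset)
  fix c assume "c \<in> (\<lambda>x. \<lambda>i\<in>I. Y i x) ` space M"
  then have c: "c \<in> extensional I" by auto
  have "{x \<in> space M. (\<lambda>i\<in>I. Y i x) = c} = {x \<in> space M. \<forall>i\<in>I. Y i x = c i}"
    using c by (auto simp: fun_eq_iff extensional_def restrict_def)
  also have "\<dots> \<in> sets M"
    using assms by (intro sets.sets_Collect_finite_All' sets.sets_Collect_finite_All)
      (auto intro: discrete_rv_sets)
  finally show "{x \<in> space M. (\<lambda>i\<in>I. Y i x) = c} \<in> sets M" .
qed

lemma level_sets_cong:
  assumes "\<And>x y. x \<in> space M \<Longrightarrow> y \<in> space M \<Longrightarrow> Y x = Y y \<longleftrightarrow> Z x = Z y"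
  shows "level_sets M Y = level_sets M Z"
  unfolding level_sets_def using assms by (intro image_cong) auto

lemma partition_on_unique:
  assumes "partition_on S \<alpha>" "A \<in> \<alpha>" "B \<in> \<alpha>" "x \<in> A" "x \<in> B"
  shows "A = B"
  using assms unfolding partition_on_def disjoint_def by blast

lemma partition_on_the:
  assumes "partition_on S \<alpha>" "A \<in> \<alpha>" "x \<in> A"
  shows "(THE A. A \<in> \<alpha> \<and> x \<in> A) = A"
  by (rule the_equality) (use assms partition_on_unique[OF assms(1)] in blast)+

lemma level_sets_partition:
  assumes P: "partition_on (space M) \<alpha>"
  shows "\<alpha> = level_sets M (\<lambda>x. THE A. A \<in> \<alpha> \<and> x \<in> A)"
proof -
  define c where "c = (\<lambda>x. THE A. A \<in> \<alpha> \<and> x \<in> A)"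
  have U: "\<Union>\<alpha> = space M" and N: "{} \<notin> \<alpha>" using P unfolding partition_on_def by blast+
  have c: "c x = A" if "A \<in> \<alpha>" "x \<in> A" for A x
    unfolding c_def using P that by (rule partition_on_the)
  have ex: "\<exists>A\<in>\<alpha>. x \<in> A" if "x \<in> space M" for x using that U by blast
  have lev: "{y \<in> space M. c y = c x} = A" if A: "A \<in> \<alpha>" "x \<in> A" for A x
  proof (intro equalityI subsetI)
    fix y assume "y \<in> {y \<in> space M. c y = c x}"
    then have y: "y \<in> space M" "c y = A" using c[OF A] by simp_all
    from ex[OF y(1)] obtain B where B: "B \<in> \<alpha>" "y \<in> B" by blast
    then show "y \<in> A" using c[OF B] y(2) by simp
  next
    fix y assume y: "y \<in> A"
    then show "y \<in> {y \<in> space M. c y = c x}" using c[OF A(1) y] c[OF A] U A(1) by auto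
  qed
  show ?thesis unfolding level_sets_def c_def[symmetric]
  proof (intro equalityI subsetI)
    fix A assume A: "A \<in> \<alpha>"
    then obtain x where x: "x \<in> A" using N by (metis all_not_in_conv)
    then have "x \<in> space M" using A U by blast
    then show "A \<in> (\<lambda>x. {y \<in> space M. c y = c x}) ` space M"
      using lev[OF A x] by blast
  next
    fix A assume "A \<in> (\<lambda>x. {y \<in> space M. c y = c x}) ` space M"
    then obtain x where x: "x \<in> space M" "A = {y \<in> space M. c y = c x}" by blast
    then show "A \<in> \<alpha>" using ex[OF x(1)] lev by metis
  qed
qed

text \<open>When \<open>f\<close> is not surjective, pulling a cell back may give the empty set, which is not a level set.\<close>

lemma level_sets_pullback:
  assumes f: "f \<in> space M \<rightarrow> space M"
  shows "pullback M f (level_sets M Y) - {{}} = level_sets M (\<lambda>x. Y (f x))"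
proof -
  let ?C = "\<lambda>z. {y \<in> space M. Y (f y) = Y z}"
  have vimage: "f -` {y \<in> space M. Y y = Y z} \<inter> space M = ?C z" for z
    using f by auto
  then have pb: "pullback M f (level_sets M Y) = ?C ` space M"
    unfolding pullback_def level_sets_def image_image by simp
  show ?thesis
  proof (intro equalityI subsetI)
    fix A assume "A \<in> pullback M f (level_sets M Y) - {{}}"
    then obtain z where z: "A = ?C z" "A \<noteq> {}" unfolding pb by blast
    then obtain x where x: "x \<in> space M" "Y (f x) = Y z" by blast
    have "A = {y \<in> space M. Y (f y) = Y (f x)}" unfolding z(1) x(2) ..
    then show "A \<in> level_sets M (\<lambda>x. Y (f x))" unfolding level_sets_def using x(1) by blast
  next
    fix A assume "A \<in> level_sets M (\<lambda>x. Y (f x))"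
    then obtain x where x: "x \<in> space M" "A = ?C (f x)" unfolding level_sets_def by blast
    moreover have "f x \<in> space M" "x \<in> A" using x f by auto
    ultimately show "A \<in> pullback M f (level_sets M Y) - {{}}" unfolding pb by blast
  qed
qed

lemma level_sets_common_refinement:
  assumes I: "I \<noteq> {}" and P: "\<And>i. i \<in> I \<Longrightarrow> P i - {{}} = level_sets M (Y i)"
  shows "common_refinement (P ` I) = level_sets M (\<lambda>x. \<lambda>i\<in>I. Y i x)"
proof -
  have ext: "(\<lambda>i\<in>I. Y i y) = (\<lambda>i\<in>I. Y i x) \<longleftrightarrow> (\<forall>i\<in>I. Y i y = Y i x)" for x y
    by (auto simp: fun_eq_iff restrict_def)
  have cell: "A = {y \<in> space M. Y i y = Y i x}" if "i \<in> I" "A \<in> P i" "x \<in> A" for i A x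
  proof -
    have "A \<in> level_sets M (Y i)" unfolding P[OF that(1), symmetric] using that by auto
    then obtain z where "A = {y \<in> space M. Y i y = Y i z}"
      unfolding level_sets_def by auto
    then show ?thesis using that(3) by auto
  qed
  have cell': "{y \<in> space M. Y i y = Y i x} \<in> P i" if "i \<in> I" "x \<in> space M" for i x
  proof -
    have "{y \<in> space M. Y i y = Y i x} \<in> level_sets M (Y i)"
      unfolding level_sets_def using that by auto
    then show ?thesis unfolding P[OF that(1), symmetric] by auto
  qed
  show ?thesis
  proof (intro Set.set_eqI iffI)
    fix A assume "A \<in> common_refinement (P ` I)"
    then obtain f where f: "f \<in> (\<Pi> Q\<in>P ` I. Q)" "A = \<Inter> (f ` P ` I)" "A \<noteq> {}"
      by (auto simp: common_refinement)
    then obtain x where x: "x \<in> A" by auto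
    have fi: "f (P i) = {y \<in> space M. Y i y = Y i x}" if "i \<in> I" for i
      using f x that by (intro cell) auto
    have "A = {y \<in> space M. \<forall>i\<in>I. Y i y = Y i x}"
      unfolding f(2) using I by (auto simp: fi)
    moreover have "x \<in> space M" using x f(2) I fi by auto
    ultimately show "A \<in> level_sets M (\<lambda>x. \<lambda>i\<in>I. Y i x)"
      by (auto simp: level_sets_def ext)
  next
    fix A assume "A \<in> level_sets M (\<lambda>x. \<lambda>i\<in>I. Y i x)"
    then obtain x where x: "x \<in> space M" "A = {y \<in> space M. \<forall>i\<in>I. Y i y = Y i x}"
      by (auto simp: level_sets_def ext)
    define f where "f = (\<lambda>Q. SOME B. B \<in> Q \<and> x \<in> B)"
    have f: "f (P i) \<in> P i \<and> x \<in> f (P i)" if "i \<in> I" for i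
      unfolding f_def by (rule someI[of _ "{y \<in> space M. Y i y = Y i x}"]) (use cell'[OF that x(1)] x(1) in simp)
    have fi: "f (P i) = {y \<in> space M. Y i y = Y i x}" if "i \<in> I" for i
      using f[OF that] that by (intro cell) auto
    have "A = \<Inter> (f ` P ` I)"
      unfolding x(2) using I by (auto simp: fi)
    moreover have "f \<in> (\<Pi> Q\<in>P ` I. Q)" using f by auto
    moreover have "A \<noteq> {}" using x by auto
    ultimately show "A \<in> common_refinement (P ` I)"
      unfolding common_refinement by blast
  qed
qed

lemma level_sets_common_refinement2:
  assumes "P - {{}} = level_sets M Y" "Q - {{}} = level_sets M Z"
  shows "common_refinement {P, Q} = level_sets M (\<lambda>x. (Y x, Z x))"
proof -
  have "common_refinement ((\<lambda>b. if b then P else Q) ` UNIV) =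
      level_sets M (\<lambda>x. \<lambda>b\<in>UNIV. if b then Inl (Y x) else Inr (Z x))"
  proof (rule level_sets_common_refinement)
    fix b :: bool
    show "(if b then P else Q) - {{}} = level_sets M (\<lambda>x. if b then Inl (Y x) else Inr (Z x))"
      using assms by (auto simp: level_sets_def)
  qed auto
  also have "(\<lambda>b. if b then P else Q) ` UNIV = {P, Q}" by (auto simp: UNIV_bool)
  also have "level_sets M (\<lambda>x. \<lambda>b\<in>UNIV. if b then Inl (Y x) else Inr (Z x)) = level_sets M (\<lambda>x. (Y x, Z x))"
  proof (rule level_sets_cong)
    fix x y
    show "(\<lambda>b\<in>UNIV. if b then Inl (Y x) else Inr (Z x)) = (\<lambda>b\<in>UNIV. if b then Inl (Y y) else Inr (Z y))
        \<longleftrightarrow> (Y x, Z x) = (Y y, Z y)"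
      by (simp add: fun_eq_iff all_bool_eq)
  qed
  finally show ?thesis .
qed

context prob_space
begin

text \<open>The range of \<open>Y\<close> is countable, so the values of probability zero form a null set and the
distribution is purely atomic.\<close>

lemma measure_pmf_law:
  assumes Y: "discrete_rv M Y"
  shows "measure_pmf (law M Y) = distr M (count_space UNIV) Y"
proof -
  have [measurable]: "Y \<in> measurable M (count_space UNIV)" using Y by (simp add: discrete_rv_def)
  interpret D: prob_space "distr M (count_space UNIV) Y" by (rule prob_space_distr) simp
  let ?N = "\<Union>c \<in> {c \<in> Y ` space M. prob {x \<in> space M. Y x = c} = 0}. {x \<in> space M. Y x = c}"
  have m: "measure (distr M (count_space UNIV) Y) {c} = prob {x \<in> space M. Y x = c}" for c
  proof -
    have "Y -` {c} \<inter> space M = {x \<in> space M. Y x = c}" by auto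
    then show ?thesis by (simp add: measure_distr)
  qed
  have "?N \<in> null_sets M"
  proof (rule null_sets_UN')
    show "countable {c \<in> Y ` space M. prob {x \<in> space M. Y x = c} = 0}"
      using Y by (auto simp: discrete_rv_def)
    fix c assume "c \<in> {c \<in> Y ` space M. prob {x \<in> space M. Y x = c} = 0}"
    then show "{x \<in> space M. Y x = c} \<in> null_sets M"
      using discrete_rv_sets[OF Y, of c] by (intro null_setsI) (auto simp: emeasure_eq_measure)
  qed
  then have "AE x in M. prob {y \<in> space M. Y y = Y x} \<noteq> 0"
    by (rule AE_I') auto
  then have "AE c in distr M (count_space UNIV) Y. measure (distr M (count_space UNIV) Y) {c} \<noteq> 0"
    unfolding m by (subst AE_distr_iff) simp_all
  then show ?thesis
    unfolding law_def using D.prob_space_axioms by (intro Abs_pmf_inverse) simp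
qed

lemma pmf_law: "discrete_rv M Y \<Longrightarrow> pmf (law M Y) c = prob {x \<in> space M. Y x = c}"
proof -
  assume Y: "discrete_rv M Y"
  have "Y -` {c} \<inter> space M = {x \<in> space M. Y x = c}" by auto
  with Y show ?thesis
    by (simp add: pmf.rep_eq measure_pmf_law measure_distr discrete_rv_def)
qed

lemma law_comp:
  assumes "discrete_rv M Y"
  shows "law M (\<lambda>x. f (Y x)) = map_pmf f (law M Y)"
proof -
  have "Y \<in> measurable M (count_space UNIV)" using assms by (simp add: discrete_rv_def)
  then have "distr (distr M (count_space UNIV) Y) (count_space UNIV) f = distr M (count_space UNIV) (f \<circ> Y)"
    by (intro distr_distr) auto
  then show ?thesis
    unfolding measure_pmf_inject[symmetric] map_pmf_rep_eq measure_pmf_law[OF assms]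
      measure_pmf_law[OF discrete_rv_comp[OF assms]] o_def by simp
qed

lemma set_pmf_law:
  assumes "discrete_rv M Y" "c \<in> set_pmf (law M Y)"
  shows "\<exists>x\<in>space M. Y x = c"
proof -
  have "prob {x \<in> space M. Y x = c} \<noteq> 0"
    using assms(2) unfolding set_pmf_iff pmf_law[OF assms(1)] .
  then have "{x \<in> space M. Y x = c} \<noteq> {}" by force
  then show ?thesis by blast
qed

lemma rv_entropy_level_sets:
  assumes Y: "discrete_rv M Y"
  shows "partition_entropy M (level_sets M Y) = rv_entropy M Y"
proof -
  let ?C = "\<lambda>c. {y \<in> space M. Y y = c}"
  let ?h = "\<lambda>A. ennreal (- (prob A * ln (prob A)))"
  have ls: "level_sets M Y = ?C ` Y ` space M" by (auto simp: level_sets_def)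
  have bij: "bij_betw ?C (Y ` space M) (level_sets M Y)"
    unfolding ls by (rule inj_on_imp_bij_betw) (auto simp: inj_on_def)
  have "rv_entropy M Y = (\<integral>\<^sup>+c. ?h (?C c) \<partial>count_space UNIV)"
    unfolding rv_entropy_def pmf_entropy_def nn_integral_measure_pmf
    by (intro nn_integral_cong)
      (simp add: pmf_law[OF Y] ennreal_mult'[symmetric])
  also have "\<dots> = (\<integral>\<^sup>+c. ?h (?C c) \<partial>count_space (Y ` space M))"
  proof (rule nn_integral_count_space_eq)
    fix c assume "c \<in> UNIV - Y ` space M"
    then have "?C c = {}" by auto
    then show "?h (?C c) = 0" by (simp only: measure_empty) simp
  qed auto
  also have "\<dots> = (\<integral>\<^sup>+A. ?h A \<partial>count_space (level_sets M Y))"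
    by (rule nn_integral_bij_count_space[OF bij])
  also have "\<dots> = partition_entropy M (level_sets M Y)"
    unfolding partition_entropy_def
    using Y by (intro nn_integral_count_space_eq_infsum) (auto simp: ls discrete_rv_def)
  finally show ?thesis by simp
qed

lemma rv_entropy_cong:
  assumes "discrete_rv M Y" "discrete_rv M Z"
    "\<And>x y. x \<in> space M \<Longrightarrow> y \<in> space M \<Longrightarrow> Y x = Y y \<longleftrightarrow> Z x = Z y"
  shows "rv_entropy M Y = rv_entropy M Z"
  using rv_entropy_level_sets[OF assms(1)] rv_entropy_level_sets[OF assms(2)]
    level_sets_cong[of M Y Z] assms(3) by simp

lemma rv_entropy_const: "rv_entropy M (\<lambda>_. c) = 0"
proof -
  have d: "discrete_rv M (\<lambda>_. c)" by (auto simp: discrete_rv_def intro: countable_subset[of _ "{c}"])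
  have z: "ennreal (pmf (law M (\<lambda>_. c)) x) * ennreal (- ln (pmf (law M (\<lambda>_. c)) x)) = 0" for x
    by (cases "x = c") (auto simp: pmf_law[OF d] prob_space)
  then show ?thesis
    unfolding rv_entropy_def pmf_entropy_def nn_integral_measure_pmf z by simp
qed

lemma rv_entropy_strong_subadditive:
  assumes Y: "discrete_rv M Y" and Z: "discrete_rv M Z"
    and uv: "\<And>x. x \<in> space M \<Longrightarrow> u (Y x) = v (Z x)"
  shows "rv_entropy M (\<lambda>x. (Y x, Z x)) + rv_entropy M (\<lambda>x. u (Y x)) \<le> rv_entropy M Y + rv_entropy M Z"
proof -
  note YZ = discrete_rv_Pair[OF Y Z]
  let ?p = "law M (\<lambda>x. (Y x, Z x))"
  have marg: "map_pmf fst ?p = law M Y" "map_pmf snd ?p = law M Z"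
      "map_pmf (\<lambda>x. u (fst x)) ?p = law M (\<lambda>x. u (Y x))"
    using law_comp[OF YZ, of fst] law_comp[OF YZ, of snd] law_comp[OF YZ, of "\<lambda>x. u (fst x)"]
    by (simp_all only: fst_conv snd_conv)
  have "u a = v b" if "(a, b) \<in> set_pmf (law M (\<lambda>x. (Y x, Z x)))" for a b
    using set_pmf_law[OF YZ that] uv by auto
  from pmf_entropy_strong_subadditive[of "law M (\<lambda>x. (Y x, Z x))" u v, OF this]
  show ?thesis
    by (simp only: rv_entropy_def marg)
qed

text \<open>The equality case of strong subadditivity: \<open>Y\<close> and \<open>Z\<close> are conditionally independent given their
common part. The products avoid division, so atoms of probability zero need no special treatment.\<close>

lemma rv_entropy_eq_iff_cond_indep:
  assumes Y: "discrete_rv M Y" and Z: "discrete_rv M Z"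
    and uv: "\<And>x. x \<in> space M \<Longrightarrow> u (Y x) = v (Z x)"
    and fin: "rv_entropy M Y < \<infinity>" "rv_entropy M Z < \<infinity>"
  shows "rv_entropy M (\<lambda>x. (Y x, Z x)) + rv_entropy M (\<lambda>x. u (Y x)) = rv_entropy M Y + rv_entropy M Z
    \<longleftrightarrow> (\<forall>a b. u a = v b \<longrightarrow>
          prob {x \<in> space M. Y x = a \<and> Z x = b} * prob {x \<in> space M. u (Y x) = u a} =
          prob {x \<in> space M. Y x = a} * prob {x \<in> space M. Z x = b})" (is "_ \<longleftrightarrow> ?R")
proof -
  let ?p = "law M (\<lambda>x. (Y x, Z x))"
  note YZ = discrete_rv_Pair[OF Y Z]
  have marg: "map_pmf fst ?p = law M Y" "map_pmf snd ?p = law M Z"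
      "map_pmf (\<lambda>x. u (fst x)) ?p = law M (\<lambda>x. u (Y x))"
    using law_comp[OF YZ, of fst] law_comp[OF YZ, of snd] law_comp[OF YZ, of "\<lambda>x. u (fst x)"]
    by (simp_all only: fst_conv snd_conv)
  have uv': "u a = v b" if "(a, b) \<in> set_pmf ?p" for a b
    using set_pmf_law[OF YZ that] uv by auto
  have "rv_entropy M (\<lambda>x. (Y x, Z x)) + rv_entropy M (\<lambda>x. u (Y x)) = rv_entropy M Y + rv_entropy M Z
     \<longleftrightarrow> (\<forall>x. pmf ?p x = cond_indep_density ?p u v x)"
    using pmf_entropy_strong_subadditive_eq_iff[of ?p u v, OF uv'] fin
    by (simp only: rv_entropy_def marg)
  also have "\<dots> \<longleftrightarrow> ?R"
  proof -
    have "pmf ?p (a, b) = cond_indep_density ?p u v (a, b) \<longleftrightarrow>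
        (u a = v b \<longrightarrow>
          prob {x \<in> space M. Y x = a \<and> Z x = b} * prob {x \<in> space M. u (Y x) = u a} =
          prob {x \<in> space M. Y x = a} * prob {x \<in> space M. Z x = b})" for a b
    proof (cases "u a = v b")
      case True
      have zero: "prob {x \<in> space M. Y x = a \<and> Z x = b} = 0 \<and> prob {x \<in> space M. Y x = a} = 0"
        if z: "prob {x \<in> space M. u (Y x) = u a} = 0"
      proof -
        have "prob {x \<in> space M. Y x = a} \<le> prob {x \<in> space M. u (Y x) = u a}"
          using discrete_rv_sets[OF discrete_rv_comp[OF Y]] by (intro finite_measure_mono) auto
        moreover have "prob {x \<in> space M. Y x = a \<and> Z x = b} \<le> prob {x \<in> space M. Y x = a}"
          using discrete_rv_sets[OF Y] by (intro finite_measure_mono) auto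
        ultimately show ?thesis using z by (smt (verit) measure_nonneg)
      qed
      have frac: "j = p * q / c \<longleftrightarrow> j * c = p * q" if "c = 0 \<Longrightarrow> j = 0 \<and> p = 0" for j c p q :: real
        using that by (cases "c = 0") (simp_all add: nonzero_eq_divide_eq)
      have "pmf ?p (a, b) = prob {x \<in> space M. Y x = a \<and> Z x = b}"
        by (simp add: pmf_law[OF YZ])
      moreover have "cond_indep_density ?p u v (a, b) = prob {x \<in> space M. Y x = a} * prob {x \<in> space M. Z x = b} /
          prob {x \<in> space M. u (Y x) = u a}"
        using True by (simp add: cond_indep_density_def marg pmf_law[OF Y] pmf_law[OF Z] pmf_law[OF discrete_rv_comp[OF Y]])
      ultimately show ?thesis
        using True frac[OF zero] by simp
    next
      case False
      then have "pmf ?p (a, b) = 0" using uv' by (auto simp: set_pmf_iff)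
      then show ?thesis using False by (simp add: cond_indep_density_def)
    qed
    then show ?thesis by auto
  qed
  finally show ?thesis .
qed

end

section \<open>Entropy of the labels at finitely many group elements\<close>

lemma level_sets_no_empty: "level_sets M Y - {{}} = level_sets M Y"
  by (auto simp: level_sets_def)

text \<open>The setting up to the structure of \<open>G\<close>: the results below hold for the action of any monoid. The
cells of \<open>\<alpha>\<close> are regarded as labels of points.\<close>

locale labelled_action = prob_space M + monoid G
  for G :: "('g, 'b) monoid_scheme" (structure) and T :: "'g \<Rightarrow> 'x \<Rightarrow> 'x"
    and M :: "'x measure" and \<alpha> :: "'x set set" +
  assumes T_pres: "\<And>g. g \<in> carrier G \<Longrightarrow> measure_preserving_map M (T g)"
    and T_one: "\<And>x. x \<in> space M \<Longrightarrow> T \<one> x = x"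
    and T_mult: "\<And>g h x. g \<in> carrier G \<Longrightarrow> h \<in> carrier G \<Longrightarrow> x \<in> space M \<Longrightarrow>
        T (g \<otimes> h) x = T g (T h x)"
    and part: "partition_on (space M) \<alpha>" and part_sets: "\<alpha> \<subseteq> sets M" and part_countable: "countable \<alpha>"
    and finite_ent: "partition_entropy M \<alpha> < \<infinity>"
begin

definition cell :: "'x \<Rightarrow> 'x set" where
  "cell x = (THE A. A \<in> \<alpha> \<and> x \<in> A)"

definition label :: "'g set \<Rightarrow> 'x \<Rightarrow> 'g \<Rightarrow> 'x set" where
  "label K x = (\<lambda>g\<in>K. cell (T g x))"

text \<open>Real-valued, because the combinatorial arguments subtract entropies; finiteness for finite \<open>K\<close> is
\<open>rv_entropy_label_finite\<close>.\<close>

definition H :: "'g set \<Rightarrow> real" where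
  "H K = enn2real (rv_entropy M (label K))"

lemma T_measurable [measurable]: "g \<in> carrier G \<Longrightarrow> T g \<in> measurable M M"
  using T_pres unfolding measure_preserving_map_def by blast

lemma T_space: "g \<in> carrier G \<Longrightarrow> x \<in> space M \<Longrightarrow> T g x \<in> space M"
  by (rule measurable_space[OF T_measurable])

lemma cell_eq: "A \<in> \<alpha> \<Longrightarrow> x \<in> A \<Longrightarrow> cell x = A"
  unfolding cell_def using part by (rule partition_on_the)

lemma cell_mem: "x \<in> space M \<Longrightarrow> cell x \<in> \<alpha> \<and> x \<in> cell x"
proof -
  assume "x \<in> space M"
  then obtain A where "A \<in> \<alpha>" "x \<in> A" using part unfolding partition_on_def by blast
  then show ?thesis using cell_eq[of A x] by simp
qed

lemma vimage_T_eq: "h \<in> carrier G \<Longrightarrow> A \<in> \<alpha> \<Longrightarrow> T h -` A \<inter> space M = {x \<in> space M. cell (T h x) = A}"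
proof -
  assume h: "h \<in> carrier G" and A: "A \<in> \<alpha>"
  have "T h x \<in> A \<longleftrightarrow> cell (T h x) = A" if "x \<in> space M" for x
    using cell_eq[OF A, of "T h x"] cell_mem[OF T_space[OF h that]] by auto
  then show ?thesis by auto
qed

lemma discrete_cell: "g \<in> carrier G \<Longrightarrow> discrete_rv M (\<lambda>x. cell (T g x))"
proof (rule discrete_rvI)
  assume g: "g \<in> carrier G"
  have sub: "(\<lambda>x. cell (T g x)) ` space M \<subseteq> \<alpha>" using cell_mem T_space[OF g] by auto
  then show "countable ((\<lambda>x. cell (T g x)) ` space M)" using part_countable by (rule countable_subset)
  fix c assume "c \<in> (\<lambda>x. cell (T g x)) ` space M"
  then have "c \<in> \<alpha>" using sub by auto
  then show "{x \<in> space M. cell (T g x) = c} \<in> sets M"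
    using measurable_sets[OF T_measurable[OF g], of c] part_sets unfolding vimage_T_eq[OF g \<open>c \<in> \<alpha>\<close>] by blast
qed

lemma discrete_label: "finite K \<Longrightarrow> K \<subseteq> carrier G \<Longrightarrow> discrete_rv M (label K)"
  unfolding label_def by (rule discrete_rv_restrict) (auto intro: discrete_cell)

lemma label_eq_iff: "label K x = label K y \<longleftrightarrow> (\<forall>g\<in>K. cell (T g x) = cell (T g y))"
  by (auto simp: label_def fun_eq_iff)

lemma partition_eq_level_sets: "\<alpha> = level_sets M (\<lambda>x. cell (T \<one> x))"
proof -
  have "\<alpha> = level_sets M cell"
    using level_sets_partition[OF part] by (simp add: cell_def[abs_def])
  also have "\<dots> = level_sets M (\<lambda>x. cell (T \<one> x))"
    by (rule level_sets_cong) (simp add: T_one)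
  finally show ?thesis .
qed

lemma rv_entropy_translate:
  assumes g: "g \<in> carrier G" and Y: "discrete_rv M Y"
  shows "rv_entropy M (\<lambda>x. Y (T g x)) = rv_entropy M Y"
proof -
  have d: "discrete_rv M (\<lambda>x. Y (T g x))"
    using Y T_measurable[OF g] measurable_space[OF T_measurable[OF g]] unfolding discrete_rv_def
    by (auto intro: measurable_compose countable_subset[of _ "Y ` space M"])
  have "law M (\<lambda>x. Y (T g x)) = law M Y"
    unfolding measure_pmf_inject[symmetric] measure_pmf_law[OF d] measure_pmf_law[OF Y]
    using T_pres[OF g] T_measurable[OF g] Y
    by (simp add: measure_preserving_map_def discrete_rv_def distr_distr[symmetric, of Y M _ "T g", unfolded o_def])
  then show ?thesis by (simp add: rv_entropy_def)
qed

text \<open>Since \<open>T (k g) x = T k (T g x)\<close>, the label of \<open>K g\<close> at \<open>x\<close> is that of \<open>K\<close> at \<open>T g x\<close>, and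
\<open>T g\<close> preserves the measure. Only right translations arise in this way.\<close>

lemma rv_entropy_label_translate:
  assumes g: "g \<in> carrier G" and K: "finite K" "K \<subseteq> carrier G"
  shows "rv_entropy M (label ((\<lambda>k. k \<otimes> g) ` K)) = rv_entropy M (label K)"
proof -
  have "rv_entropy M (label ((\<lambda>k. k \<otimes> g) ` K)) = rv_entropy M (\<lambda>x. label K (T g x))"
  proof (rule rv_entropy_cong)
    show "discrete_rv M (label ((\<lambda>k. k \<otimes> g) ` K))" using g K by (intro discrete_label) auto
    show "discrete_rv M (\<lambda>x. label K (T g x))"
      using discrete_label[OF K] T_measurable[OF g] T_space[OF g] unfolding discrete_rv_def
      by (auto intro: measurable_compose countable_subset[of _ "label K ` space M"])
    fix x y assume "x \<in> space M" "y \<in> space M"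
    then show "label ((\<lambda>k. k \<otimes> g) ` K) x = label ((\<lambda>k. k \<otimes> g) ` K) y \<longleftrightarrow>
        label K (T g x) = label K (T g y)"
      unfolding label_eq_iff using g K(2) T_mult by (simp add: subset_iff)
  qed
  also have "\<dots> = rv_entropy M (label K)" by (rule rv_entropy_translate[OF g discrete_label[OF K]])
  finally show ?thesis .
qed

lemma rv_entropy_label_submodular:
  assumes K: "finite K" "K \<subseteq> carrier G" and L: "finite L" "L \<subseteq> carrier G" and C: "C \<subseteq> K" "C \<subseteq> L"
  shows "rv_entropy M (label (K \<union> L)) + rv_entropy M (label C) \<le>
    rv_entropy M (label K) + rv_entropy M (label L)"
proof -
  note dK = discrete_label[OF K] and dL = discrete_label[OF L]
  have r: "restrict (label K x) C = label C x" "restrict (label L x) C = label C x" for x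
    using C by (auto simp: label_def fun_eq_iff)
  have "rv_entropy M (label (K \<union> L)) = rv_entropy M (\<lambda>x. (label K x, label L x))"
    using K L by (intro rv_entropy_cong discrete_label discrete_rv_Pair) (auto simp: label_eq_iff)
  then show ?thesis
    using rv_entropy_strong_subadditive[OF dK dL, of "\<lambda>f. restrict f C" "\<lambda>f. restrict f C"]
    by (simp add: r)
qed

lemma rv_entropy_label_one: "rv_entropy M (label {\<one>}) = partition_entropy M \<alpha>"
proof -
  have "rv_entropy M (label {\<one>}) = partition_entropy M (level_sets M (label {\<one>}))"
    by (rule rv_entropy_level_sets[symmetric]) (auto intro: discrete_label)
  also have "level_sets M (label {\<one>}) = level_sets M (\<lambda>x. cell (T \<one> x))"
    by (rule level_sets_cong) (auto simp: label_eq_iff)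
  finally show ?thesis using partition_eq_level_sets by simp
qed

text \<open>By subadditivity, as every single label has the entropy of the partition.\<close>

lemma rv_entropy_label_finite:
  assumes "finite K" "K \<subseteq> carrier G"
  shows "rv_entropy M (label K) < \<infinity>"
  using assms
proof (induction K rule: finite_induct)
  case empty
  have "label {} = (\<lambda>_. \<lambda>_. undefined)" by (simp add: label_def restrict_def fun_eq_iff)
  then show ?case by (simp add: rv_entropy_const)
next
  case (insert g K)
  have "rv_entropy M (label {g}) = partition_entropy M \<alpha>"
    using rv_entropy_label_translate[of g "{\<one>}"] insert.prems by (simp add: rv_entropy_label_one)
  then have "rv_entropy M (label K) + rv_entropy M (label {g}) < \<infinity>"
    using insert finite_ent by simp
  moreover have "rv_entropy M (label (insert g K)) + rv_entropy M (label {}) \<le>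
      rv_entropy M (label K) + rv_entropy M (label {g})"
    using rv_entropy_label_submodular[of K "{g}" "{}"] insert by simp
  ultimately show ?case
    by (meson le_less_trans add_increasing2 order_refl zero_le)
qed

lemma rv_entropy_label_H: "finite K \<Longrightarrow> K \<subseteq> carrier G \<Longrightarrow> rv_entropy M (label K) = ennreal (H K)"
  using rv_entropy_label_finite[of K] by (simp add: H_def)

lemma H_nonneg: "0 \<le> H K"
  by (simp add: H_def)

lemma H_submodular:
  assumes "finite K" "K \<subseteq> carrier G" "finite L" "L \<subseteq> carrier G" "C \<subseteq> K" "C \<subseteq> L"
  shows "H (K \<union> L) + H C \<le> H K + H L"
proof -
  have "finite C" "C \<subseteq> carrier G" using assms finite_subset by auto
  then have "ennreal (H (K \<union> L) + H C) \<le> ennreal (H K + H L)"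
    using rv_entropy_label_submodular[OF assms] assms
    by (simp add: rv_entropy_label_H H_nonneg)
  then show ?thesis using H_nonneg[of K] H_nonneg[of L] by (subst (asm) ennreal_le_iff) auto
qed

lemma H_translate:
  "g \<in> carrier G \<Longrightarrow> finite K \<Longrightarrow> K \<subseteq> carrier G \<Longrightarrow> H ((\<lambda>k. k \<otimes> g) ` K) = H K"
  by (simp add: H_def rv_entropy_label_translate)

lemma join_eq_level_sets:
  assumes K: "K \<subseteq> carrier G" "K \<noteq> {}"
  shows "common_refinement ((\<lambda>g. pullback M (T g) \<alpha>) ` K) = level_sets M (label K)"
proof -
  have cellT: "level_sets M (\<lambda>x. cell (T \<one> x)) = level_sets M cell"
    by (rule level_sets_cong) (simp add: T_one)
  have "common_refinement ((\<lambda>g. pullback M (T g) \<alpha>) ` K) = level_sets M (\<lambda>x. \<lambda>g\<in>K. cell (T g x))"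
  proof (rule level_sets_common_refinement[OF K(2)])
    fix g assume "g \<in> K"
    then have "T g \<in> space M \<rightarrow> space M" using T_space K by auto
    then show "pullback M (T g) \<alpha> - {{}} = level_sets M (\<lambda>x. cell (T g x))"
      by (subst partition_eq_level_sets) (simp only: cellT level_sets_pullback)
  qed
  then show ?thesis by (simp add: label_def[abs_def])
qed

text \<open>\<open>T \<one>\<close> is the identity only on the space itself, so the pulled back partition is compared with \<open>\<alpha>\<close>
through level sets.\<close>

lemma join_one: "common_refinement ((\<lambda>g. pullback M (T g) \<alpha>) ` {\<one>}) = \<alpha>"
proof -
  have "level_sets M (label {\<one>}) = level_sets M (\<lambda>x. cell (T \<one> x))"
    by (rule level_sets_cong) (simp add: label_eq_iff)
  also have "\<dots> = \<alpha>" by (rule partition_eq_level_sets[symmetric])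
  finally show ?thesis by (subst join_eq_level_sets) auto
qed

lemma partition_entropy_join:
  assumes K: "finite K" "K \<subseteq> carrier G" "K \<noteq> {}"
  defines "\<beta> \<equiv> common_refinement ((\<lambda>g. pullback M (T g) \<alpha>) ` K)"
  shows "partition_entropy M \<beta> = ennreal (H K)"
    and "s \<in> carrier G \<Longrightarrow> partition_entropy M (common_refinement {\<beta>, pullback M (T s) \<beta>}) =
      ennreal (H (K \<union> (\<lambda>k. k \<otimes> s) ` K))"
proof -
  have \<beta>: "\<beta> = level_sets M (label K)"
    unfolding \<beta>_def by (rule join_eq_level_sets[OF K(2,3)])
  show "partition_entropy M \<beta> = ennreal (H K)"
    using K by (simp add: \<beta> rv_entropy_level_sets discrete_label rv_entropy_label_H)
  assume s: "s \<in> carrier G"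
  have K': "finite (K \<union> (\<lambda>k. k \<otimes> s) ` K)" "K \<union> (\<lambda>k. k \<otimes> s) ` K \<subseteq> carrier G"
    using K s by auto
  have "common_refinement {\<beta>, pullback M (T s) \<beta>} = level_sets M (\<lambda>x. (label K x, label K (T s x)))"
    unfolding \<beta> using T_space[OF s]
    by (intro level_sets_common_refinement2 level_sets_no_empty level_sets_pullback) auto
  also have "\<dots> = level_sets M (label (K \<union> (\<lambda>k. k \<otimes> s) ` K))"
  proof (rule level_sets_cong)
    fix x y assume xy: "x \<in> space M" "y \<in> space M"
    have "cell (T (k \<otimes> s) z) = cell (T k (T s z))" if "k \<in> K" "z \<in> space M" for k z
      using T_mult[of k s z] s K(2) that by auto
    with xy show "(label K x, label K (T s x)) = (label K y, label K (T s y)) \<longleftrightarrow>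
        label (K \<union> (\<lambda>k. k \<otimes> s) ` K) x = label (K \<union> (\<lambda>k. k \<otimes> s) ` K) y"
      unfolding prod.inject label_eq_iff ball_Un ball_simps by simp
  qed
  finally show "partition_entropy M (common_refinement {\<beta>, pullback M (T s) \<beta>}) =
      ennreal (H (K \<union> (\<lambda>k. k \<otimes> s) ` K))"
    using K' rv_entropy_level_sets[OF discrete_label[OF K']] rv_entropy_label_H[OF K'] by simp
qed

end

section \<open>Conditional independence as an entropy identity\<close>

context labelled_action
begin

lemma label_sets:
  assumes "finite K" "K \<subseteq> carrier G"
  shows "{x \<in> space M. label K x = c} \<in> sets M"
  using discrete_label[OF assms] by (rule discrete_rv_sets)

lemma join_algebra_generators_Pow: "(\<Union>f\<in>Q. pullback M (T f) \<alpha>) \<subseteq> Pow (space M)"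
  unfolding pullback_def by blast

lemma join_algebra_generators_sets:
  assumes "Q \<subseteq> carrier G"
  shows "(\<Union>f\<in>Q. pullback M (T f) \<alpha>) \<subseteq> sets M"
  using assms part_sets measurable_sets[OF T_measurable]
  unfolding pullback_def by blast+

lemma space_join_algebra: "space (join_algebra T M \<alpha> Q) = space M"
  unfolding join_algebra_def by (rule space_measure_of_conv)

lemma sets_join_algebra:
  "sets (join_algebra T M \<alpha> Q) = sigma_sets (space M) (\<Union>f\<in>Q. pullback M (T f) \<alpha>)"
  unfolding join_algebra_def by (rule sets_measure_of[OF join_algebra_generators_Pow])

lemma subalgebra_join_algebra: "Q \<subseteq> carrier G \<Longrightarrow> subalgebra M (join_algebra T M \<alpha> Q)"
  unfolding subalgebra_def
  using sets.sigma_sets_subset[OF join_algebra_generators_sets]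
  by (simp add: space_join_algebra sets_join_algebra)

lemma sigma_finite_subalgebra_join_algebra:
  "Q \<subseteq> carrier G \<Longrightarrow> sigma_finite_subalgebra M (join_algebra T M \<alpha> Q)"
  using subalgebra_join_algebra finite_measure_axioms
  by (intro finite_measure_subalgebra_is_sigma_finite)
    (simp add: finite_measure_subalgebra_def finite_measure_subalgebra_axioms_def)

lemma cell_set_join_algebra:
  assumes Q: "Q \<subseteq> carrier G" and f: "f \<in> Q"
  shows "{x \<in> space M. cell (T f x) = A} \<in> sets (join_algebra T M \<alpha> Q)"
proof (cases "A \<in> \<alpha>")
  case True
  then have "T f -` A \<inter> space M \<in> (\<Union>f\<in>Q. pullback M (T f) \<alpha>)"
    unfolding pullback_def using f by blast
  then show ?thesis
    unfolding sets_join_algebra vimage_T_eq[OF subsetD[OF Q f] True] by (rule sigma_sets.Basic)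
next
  case False
  then have "{x \<in> space M. cell (T f x) = A} = {}"
    using cell_mem T_space f Q by blast
  then show ?thesis by (simp only: sets.empty_sets)
qed

lemma label_set_join_algebra:
  assumes Q: "Q \<subseteq> carrier G" and K: "finite K" "K \<subseteq> Q" "K \<noteq> {}"
  shows "{x \<in> space M. label K x = c} \<in> sets (join_algebra T M \<alpha> Q)"
proof (cases "c \<in> extensional K")
  case True
  then have "label K x = c \<longleftrightarrow> (\<forall>f\<in>K. cell (T f x) = c f)" for x
    unfolding label_def by (auto simp: fun_eq_iff extensional_def)
  then have "{x \<in> space M. label K x = c} = (\<Inter>f\<in>K. {x \<in> space M. cell (T f x) = c f})"
    using K(3) by blast
  also have "\<dots> \<in> sets (join_algebra T M \<alpha> Q)"
    using K cell_set_join_algebra[OF Q] by (intro sets.finite_INT) auto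
  finally show ?thesis .
next
  case False
  then have "{x \<in> space M. label K x = c} = {}" unfolding label_def by auto
  then show ?thesis by (simp only: sets.empty_sets)
qed

text \<open>A generating family on which conditional probabilities are elementary: each set fixes finitely many
labels, among them the one at \<open>g\<close>. It is closed under intersection because two compatible
prescriptions combine to one on the union of the index sets.\<close>

lemma label_cells_generate_join_algebra:
  assumes Q: "Q \<subseteq> carrier G" and g: "g \<in> Q"
  defines "\<G> \<equiv> insert {} {{x \<in> space M. label K x = c} | K c. finite K \<and> K \<subseteq> Q \<and> g \<in> K}"
  shows "sets (join_algebra T M \<alpha> Q) = sigma_sets (space M) \<G>" and "Int_stable \<G>" and "\<G> \<subseteq> Pow (space M)"
proof -
  show sub: "\<G> \<subseteq> Pow (space M)" unfolding \<G>_def by blast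
  have mem: "{x \<in> space M. label K x = c} \<in> \<G>" if "finite K" "K \<subseteq> Q" "g \<in> K" for K c
    unfolding \<G>_def using that by blast
  show "Int_stable \<G>"
  proof (rule Int_stableI)
    fix a b assume a: "a \<in> \<G>" and b: "b \<in> \<G>"
    show "a \<inter> b \<in> \<G>"
    proof (cases "a \<inter> b = {}")
      case True then show ?thesis by (simp add: \<G>_def)
    next
      case False
      then obtain z where z: "z \<in> a" "z \<in> b" by blast
      obtain K c where K: "a = {x \<in> space M. label K x = c}" "finite K" "K \<subseteq> Q" "g \<in> K"
        using a z unfolding \<G>_def by blast
      obtain L d where L: "b = {x \<in> space M. label L x = d}" "finite L" "L \<subseteq> Q" "g \<in> L"
        using b z unfolding \<G>_def by blast
      have "c = label K z" "d = label L z" using z K(1) L(1) by simp_all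
      then have "a \<inter> b = {x \<in> space M. label (K \<union> L) x = label (K \<union> L) z}"
        unfolding K(1) L(1) by (auto simp: label_eq_iff)
      then show ?thesis using mem[of "K \<union> L"] K L by simp
    qed
  qed
  show "sets (join_algebra T M \<alpha> Q) = sigma_sets (space M) \<G>"
  proof (intro equalityI)
    show "sigma_sets (space M) \<G> \<subseteq> sets (join_algebra T M \<alpha> Q)"
      unfolding space_join_algebra[of Q, symmetric]
    proof (rule sets.sigma_sets_subset)
      show "\<G> \<subseteq> sets (join_algebra T M \<alpha> Q)"
        unfolding \<G>_def using label_set_join_algebra[OF Q] by blast
    qed
    show "sets (join_algebra T M \<alpha> Q) \<subseteq> sigma_sets (space M) \<G>"
      unfolding sets_join_algebra
    proof (rule sigma_sets_mono, rule subsetI)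
      fix B assume "B \<in> (\<Union>f\<in>Q. pullback M (T f) \<alpha>)"
      then obtain f A where f: "f \<in> Q" and A: "A \<in> \<alpha>" and B: "B = T f -` A \<inter> space M"
        unfolding pullback_def by blast
      let ?K = "{f, g}"
      have K: "finite ?K" "?K \<subseteq> carrier G" using f g Q by auto
      let ?C = "label ?K ` B"
      have "B = (\<Union>c\<in>?C. {x \<in> space M. label ?K x = c})"
      proof -
        have "x \<in> B" if "x \<in> space M" "y \<in> B" "label ?K x = label ?K y" for x y
        proof -
          have "cell (T f x) = cell (T f y)" using that(3) unfolding label_eq_iff by blast
          then show ?thesis using that(1,2) unfolding B vimage_T_eq[OF subsetD[OF Q f] A] by simp
        qed
        moreover have "B \<subseteq> space M" using B by blast
        ultimately show ?thesis by blast
      qed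
      moreover have "countable ?C"
        using discrete_label[OF K] B unfolding discrete_rv_def
        by (intro countable_subset[of ?C "label ?K ` space M"]) auto
      then have "(\<Union>c\<in>?C. {x \<in> space M. label ?K x = c}) \<in> sigma_sets (space M) \<G>"
        using mem[of ?K] f g by (intro sigma_sets_UNION) auto
      ultimately show "B \<in> sigma_sets (space M) \<G>" by simp
    qed
  qed
qed

definition cell_cond_prob :: "'x set \<Rightarrow> 'g \<Rightarrow> 'x \<Rightarrow> real" where
  "cell_cond_prob B g x = prob (B \<inter> {y \<in> space M. cell (T g y) = cell (T g x)}) /
     prob {y \<in> space M. cell (T g y) = cell (T g x)}"

lemma integral_cell_cond_prob_label:
  assumes K: "finite K" "K \<subseteq> carrier G" "g \<in> K"
  shows "(\<integral>x\<in>{x \<in> space M. label K x = c}. cell_cond_prob B g x \<partial>M) =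
    prob (B \<inter> {x \<in> space M. cell (T g x) = c g}) / prob {x \<in> space M. cell (T g x) = c g} *
    prob {x \<in> space M. label K x = c}"
proof -
  let ?C = "{x \<in> space M. label K x = c}"
  let ?r = "prob (B \<inter> {x \<in> space M. cell (T g x) = c g}) / prob {x \<in> space M. cell (T g x) = c g}"
  have "cell_cond_prob B g x = ?r" if "x \<in> ?C" for x
  proof -
    have "cell (T g x) = c g" using that K(3) unfolding label_def by auto
    then show ?thesis by (simp add: cell_cond_prob_def)
  qed
  then have "(\<integral>x\<in>?C. cell_cond_prob B g x \<partial>M) = (\<integral>x\<in>?C. ?r \<partial>M)"
    using label_sets[OF K(1,2)] by (intro set_lebesgue_integral_cong) auto
  also have "\<dots> = ?r * prob ?C"
    using label_sets[OF K(1,2)] by (simp add: set_lebesgue_integral_def)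
  finally show ?thesis .
qed

lemma cell_cond_prob_measurable:
  assumes Q: "Q \<subseteq> carrier G" and g: "g \<in> Q"
  shows "cell_cond_prob B g \<in> borel_measurable (join_algebra T M \<alpha> Q)"
proof -
  let ?F = "join_algebra T M \<alpha> Q"
  have "discrete_rv ?F (\<lambda>x. cell (T g x))"
  proof (rule discrete_rvI)
    show "countable ((\<lambda>x. cell (T g x)) ` space ?F)"
      using discrete_cell[of g] Q g unfolding discrete_rv_def space_join_algebra by blast
  qed (simp add: space_join_algebra cell_set_join_algebra[OF Q g])
  then have "(\<lambda>x. cell (T g x)) \<in> measurable ?F (count_space UNIV)"
    unfolding discrete_rv_def ..
  then have "(\<lambda>x. (\<lambda>A. prob (B \<inter> {y \<in> space M. cell (T g y) = A}) /
      prob {y \<in> space M. cell (T g y) = A}) (cell (T g x))) \<in> borel_measurable ?F"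
    by (rule measurable_compose) simp
  then show ?thesis unfolding cell_cond_prob_def[abs_def] by simp
qed

lemma cell_cond_prob_bounds: "0 \<le> cell_cond_prob B g x" "cell_cond_prob B g x \<le> 1"
proof -
  let ?C = "{y \<in> space M. cell (T g y) = cell (T g x)}"
  show "0 \<le> cell_cond_prob B g x" by (simp add: cell_cond_prob_def)
  have "prob (B \<inter> ?C) \<le> prob ?C" if "?C \<in> sets M" using that by (intro finite_measure_mono) auto
  moreover have "prob ?C = 0" if "?C \<notin> sets M" using that by (rule measure_notin_sets)
  ultimately show "cell_cond_prob B g x \<le> 1"
    unfolding cell_cond_prob_def by (cases "?C \<in> sets M") (auto simp: divide_le_eq_1 less_le)
qed

text \<open>Both functions are measurable for the algebra, so they agree almost everywhere iff they have the same
integral over each of its sets, and by Dynkin's lemma it suffices to test the sets that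
generate it. There the integrals are elementary.\<close>

lemma cond_prob_eq_cell_cond_prob_iff:
  assumes Q: "Q \<subseteq> carrier G" and g: "g \<in> Q" and B: "B \<in> sets M"
  shows "(AE x in M. cond_prob_algebra M B (join_algebra T M \<alpha> Q) x = cell_cond_prob B g x) \<longleftrightarrow>
    (\<forall>K c. finite K \<and> K \<subseteq> Q \<and> g \<in> K \<longrightarrow>
      prob (B \<inter> {x \<in> space M. label K x = c}) * prob {x \<in> space M. cell (T g x) = c g} =
      prob (B \<inter> {x \<in> space M. cell (T g x) = c g}) * prob {x \<in> space M. label K x = c})"
    (is "?L \<longleftrightarrow> ?R")
proof -
  let ?F = "join_algebra T M \<alpha> Q"
  interpret F: sigma_finite_subalgebra M ?F by (rule sigma_finite_subalgebra_join_algebra[OF Q])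
  have subalg: "sets ?F \<subseteq> sets M" using subalgebra_join_algebra[OF Q] unfolding subalgebra_def by blast
  have iB: "integrable M (indicator B :: 'x \<Rightarrow> real)" using B by (simp add: emeasure_eq_measure)
  have lmF: "cell_cond_prob B g \<in> borel_measurable ?F" by (rule cell_cond_prob_measurable[OF Q g])
  then have lm: "cell_cond_prob B g \<in> borel_measurable M" by (rule measurable_from_subalg[OF subalgebra_join_algebra[OF Q]])
  have il: "integrable M (cell_cond_prob B g)"
    using cell_cond_prob_bounds by (intro integrable_const_bound[of _ 1] lm) (auto intro!: AE_I2)
  have iB_set: "(\<integral>x\<in>C. indicator B x \<partial>M) = prob (B \<inter> C)" if "C \<in> sets M" for C
    using that B by (simp add: set_lebesgue_integral_def indicator_inter_arith[symmetric] Int_commute)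
  have frac: "j = p / c * q \<longleftrightarrow> j * c = p * q" if "c = 0 \<Longrightarrow> j = 0 \<and> q = 0" for j c p q :: real
    using that by (cases "c = 0") (simp_all add: nonzero_eq_divide_eq)
  have key: "(\<integral>x\<in>{x \<in> space M. label K x = c}. indicator B x \<partial>M) =
        (\<integral>x\<in>{x \<in> space M. label K x = c}. cell_cond_prob B g x \<partial>M) \<longleftrightarrow>
      prob (B \<inter> {x \<in> space M. label K x = c}) * prob {x \<in> space M. cell (T g x) = c g} =
      prob (B \<inter> {x \<in> space M. cell (T g x) = c g}) * prob {x \<in> space M. label K x = c}"
    if K: "finite K" "K \<subseteq> Q" "g \<in> K" for K c
  proof -
    have K': "K \<subseteq> carrier G" using K Q by blast
    have "{x \<in> space M. label K x = c} \<subseteq> {x \<in> space M. cell (T g x) = c g}"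
      using K(3) unfolding label_def by auto
    moreover have "{x \<in> space M. cell (T g x) = c g} \<in> sets M"
      using discrete_rv_sets[OF discrete_cell] g Q by blast
    ultimately have le: "prob {x \<in> space M. label K x = c} \<le> prob {x \<in> space M. cell (T g x) = c g}"
      by (rule finite_measure_mono)
    have le': "prob (B \<inter> {x \<in> space M. label K x = c}) \<le> prob {x \<in> space M. label K x = c}"
      using label_sets[OF K(1) K'] by (intro finite_measure_mono) auto
    have "prob (B \<inter> {x \<in> space M. label K x = c}) = 0 \<and> prob {x \<in> space M. label K x = c} = 0"
      if "prob {x \<in> space M. cell (T g x) = c g} = 0"
      using le le' that by (smt (verit) measure_nonneg)
    from frac[OF this] show ?thesis
      unfolding iB_set[OF label_sets[OF K(1) K']] integral_cell_cond_prob_label[OF K(1) K' K(3)] .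
  qed
  note gen = label_cells_generate_join_algebra[OF Q g]
  have add: "(\<integral>x\<in>(\<Union>i. A i). f x \<partial>M) = (\<Sum>i. (\<integral>x\<in>A i. f x \<partial>M))"
    if f: "integrable M f" and A: "\<And>i. A i \<in> sets M" and dis: "disjoint_family A"
    for f :: "'x \<Rightarrow> real" and A :: "nat \<Rightarrow> 'x set"
  proof (rule lebesgue_integral_countable_add)
    show "A i \<inter> A j = {}" if "i \<noteq> j" for i j
      using dis that unfolding disjoint_family_on_def by blast
    have "(\<Union>i. A i) \<in> sets M" using A by blast
    then show "set_integrable M (\<Union>i. A i) f"
      unfolding set_integrable_def using f by (rule integrable_mult_indicator)
  qed (rule A)
  show ?thesis
  proof
    assume ?L
    then have L: "AE x in M. real_cond_exp M ?F (indicator B) x = cell_cond_prob B g x"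
      unfolding cond_prob_algebra_def .
    have "(\<integral>x\<in>C. indicator B x \<partial>M) = (\<integral>x\<in>C. cell_cond_prob B g x \<partial>M)" if C: "C \<in> sets ?F" for C
    proof -
      have "(\<integral>x\<in>C. indicator B x \<partial>M) = (\<integral>x\<in>C. real_cond_exp M ?F (indicator B) x \<partial>M)"
        by (rule F.real_cond_exp_intA[OF iB C])
      also have "\<dots> = (\<integral>x\<in>C. cell_cond_prob B g x \<partial>M)"
        unfolding set_lebesgue_integral_def using L lm C subalg
        by (intro integral_cong_AE) (auto intro!: borel_measurable_scaleR borel_measurable_indicator)
      finally show ?thesis .
    qed
    then show ?R using key label_set_join_algebra[OF Q] by blast
  next
    assume R: ?R
    have "(\<integral>x\<in>C. indicator B x \<partial>M) = (\<integral>x\<in>C. cell_cond_prob B g x \<partial>M)" if C: "C \<in> sets ?F" for C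
      using gen(2,3) C unfolding gen(1)
    proof (induction rule: sigma_sets_induct_disjoint)
      case (basic A)
      then show ?case using key R by (auto simp: set_lebesgue_integral_def)
    next
      case empty
      show ?case by (simp add: set_lebesgue_integral_def)
    next
      case (compl A)
      have A: "A \<in> sets M" using compl(1) subalg unfolding gen(1) by blast
      have "(\<integral>x\<in>space M - A. f x \<partial>M) = (\<integral>x. f x \<partial>M) - (\<integral>x\<in>A. f x \<partial>M)"
        if f: "integrable M f" for f :: "'x \<Rightarrow> real"
      proof -
        have "(\<integral>x. f x \<partial>M) = (\<integral>x\<in>space M. f x \<partial>M)"
          by (rule set_integral_space[OF f, symmetric])
        also have "\<dots> = (\<integral>x\<in>A \<union> (space M - A). f x \<partial>M)"
          using sets.sets_into_space[OF A] by (simp add: Un_absorb1)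
        also have "\<dots> = (\<integral>x\<in>A. f x \<partial>M) + (\<integral>x\<in>space M - A. f x \<partial>M)"
          using A f unfolding set_integrable_def
          by (intro set_integral_Un) (auto simp only: set_integrable_def intro!: integrable_mult_indicator)
        finally show ?thesis by simp
      qed
      moreover have "(\<integral>x. indicator B x \<partial>M) = (\<integral>x. cell_cond_prob B g x \<partial>M)"
      proof -
        \<comment> \<open>the total integrals agree because the level sets of the label at \<open>g\<close> form a countable
          partition of the space; empty sets pad it to a sequence\<close>
        let ?I = "label {g} ` space M"
        have g': "{g} \<subseteq> carrier G" using g Q by blast
        define A where "A n = {x \<in> space M. to_nat_on ?I (label {g} x) = n}" for n
        have I: "countable ?I"
          using discrete_label[OF _ g'] unfolding discrete_rv_def by blast
        have An: "A n = {} \<or> (\<exists>c. A n = {x \<in> space M. label {g} x = c})" for n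
        proof (cases "A n = {}")
          case False
          then obtain z where z: "z \<in> space M" "to_nat_on ?I (label {g} z) = n"
            unfolding A_def by blast
          have "to_nat_on ?I (label {g} x) = n \<longleftrightarrow> label {g} x = label {g} z" if "x \<in> space M" for x
            using z that to_nat_on_inj[OF I, of "label {g} x" "label {g} z"] by auto
          then show ?thesis unfolding A_def by auto
        qed simp
        have eq: "(\<integral>x\<in>A n. indicator B x \<partial>M) = (\<integral>x\<in>A n. cell_cond_prob B g x \<partial>M)" for n
          using An[of n] key[of "{g}"] R g by (auto simp: set_lebesgue_integral_def)
        have Am: "A n \<in> sets M" for n
          using An[of n] label_sets[OF _ g'] by auto
        have dis: "disjoint_family A" unfolding disjoint_family_on_def A_def by blast
        have "(\<Union>n. A n) = space M" unfolding A_def by blast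
        then have "(\<integral>x\<in>space M. indicator B x \<partial>M) = (\<integral>x\<in>space M. cell_cond_prob B g x \<partial>M)"
          using add[OF iB Am dis] add[OF il Am dis] eq by simp
        then show ?thesis using set_integral_space[OF il] set_integral_space[OF iB] by simp
      qed
      ultimately show ?case using compl(2) iB il by simp
    next
      case (union A)
      have A: "A i \<in> sets M" for i using union(2) subalg unfolding gen(1) by blast
      show ?case using add[OF iB A union(1)] add[OF il A union(1)] union(3) by simp
    qed
    then have "AE x in M. real_cond_exp M ?F (indicator B) x = cell_cond_prob B g x"
      using iB il lmF by (intro F.real_cond_exp_charact) auto
    then show ?L unfolding cond_prob_algebra_def .
  qed
qed

text \<open>Conditioning on infinitely many labels is reduced to finitely many at a time, where the product
formula is the equality case of strong subadditivity for the pair of labels at \<open>g\<close> and \<open>h\<close> against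
the labels on \<open>K\<close>; their common part is the label at \<open>g\<close>.\<close>

lemma cond_prob_eq_iff_entropy:
  assumes Q: "Q \<subseteq> carrier G" and g: "g \<in> Q" and h: "h \<in> carrier G"
  shows "(\<forall>A\<in>\<alpha>. AE x in M.
      cond_prob_algebra M (T h -` A \<inter> space M) (join_algebra T M \<alpha> Q) x =
      cond_prob_algebra M (T h -` A \<inter> space M) (join_algebra T M \<alpha> {g}) x) \<longleftrightarrow>
    (\<forall>K. finite K \<and> K \<subseteq> Q \<and> g \<in> K \<longrightarrow> H (insert h K) + H {g} = H K + H {g, h})"
    (is "?L \<longleftrightarrow> ?R")
proof -
  have gG: "g \<in> carrier G" using g Q by blast
  let ?B = "\<lambda>A. {x \<in> space M. cell (T h x) = A}"
  let ?g = "\<lambda>a. {x \<in> space M. cell (T g x) = a}"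
  let ?K = "\<lambda>K c. {x \<in> space M. label K x = c}"
  have B: "?B A \<in> sets M" for A
    by (rule discrete_rv_sets[OF discrete_cell[OF h]])
  \<comment> \<open>conditioning on the single coordinate gives the elementary conditional probability\<close>
  have single: "AE x in M. cond_prob_algebra M (?B A) (join_algebra T M \<alpha> {g}) x = cell_cond_prob (?B A) g x" for A
  proof -
    have "prob (?B A \<inter> ?K K c) * prob (?g (c g)) = prob (?B A \<inter> ?g (c g)) * prob (?K K c)"
      if K: "finite K \<and> K \<subseteq> {g} \<and> g \<in> K" for K c
    proof (cases "c \<in> extensional {g}")
      case True
      have "K = {g}" using K by blast
      then have "?K K c = ?g (c g)" using True
        by (auto simp: label_def fun_eq_iff extensional_def)
      then show ?thesis by simp
    next
      case False
      then have "?K K c = {}" using K unfolding label_def by (auto simp: subset_singleton_iff)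
      then show ?thesis by (simp only: Int_empty_right measure_empty)
    qed
    then show ?thesis using gG B by (subst cond_prob_eq_cell_cond_prob_iff) auto
  qed
  have "?L \<longleftrightarrow> (\<forall>A\<in>\<alpha>. AE x in M.
      cond_prob_algebra M (?B A) (join_algebra T M \<alpha> Q) x = cell_cond_prob (?B A) g x)"
  proof (rule ball_cong[OF refl])
    fix A assume A: "A \<in> \<alpha>"
    show "(AE x in M. cond_prob_algebra M (T h -` A \<inter> space M) (join_algebra T M \<alpha> Q) x =
        cond_prob_algebra M (T h -` A \<inter> space M) (join_algebra T M \<alpha> {g}) x) \<longleftrightarrow>
      (AE x in M. cond_prob_algebra M (?B A) (join_algebra T M \<alpha> Q) x = cell_cond_prob (?B A) g x)"
      unfolding vimage_T_eq[OF h A]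
    proof
      assume "AE x in M. cond_prob_algebra M (?B A) (join_algebra T M \<alpha> Q) x =
        cond_prob_algebra M (?B A) (join_algebra T M \<alpha> {g}) x"
      with single[of A] show "AE x in M. cond_prob_algebra M (?B A) (join_algebra T M \<alpha> Q) x = cell_cond_prob (?B A) g x"
        by eventually_elim (simp only:)
    next
      assume "AE x in M. cond_prob_algebra M (?B A) (join_algebra T M \<alpha> Q) x = cell_cond_prob (?B A) g x"
      with single[of A] show "AE x in M. cond_prob_algebra M (?B A) (join_algebra T M \<alpha> Q) x =
        cond_prob_algebra M (?B A) (join_algebra T M \<alpha> {g}) x"
        by eventually_elim (simp only:)
    qed
  qed
  also have "\<dots> \<longleftrightarrow> (\<forall>A\<in>\<alpha>. \<forall>K c. finite K \<and> K \<subseteq> Q \<and> g \<in> K \<longrightarrow>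
      prob (?B A \<inter> ?K K c) * prob (?g (c g)) = prob (?B A \<inter> ?g (c g)) * prob (?K K c))"
    by (simp only: cond_prob_eq_cell_cond_prob_iff[OF Q g B])
  also have "\<dots> \<longleftrightarrow> (\<forall>K. finite K \<and> K \<subseteq> Q \<and> g \<in> K \<longrightarrow> (\<forall>A c.
      prob (?B A \<inter> ?K K c) * prob (?g (c g)) = prob (?B A \<inter> ?g (c g)) * prob (?K K c)))"
  proof -
    have "prob (?B A \<inter> ?K K c) * prob (?g (c g)) = prob (?B A \<inter> ?g (c g)) * prob (?K K c)"
      if "A \<notin> \<alpha>" for A K c
    proof -
      have "?B A = {}" using that cell_mem T_space[OF h] by blast
      then show ?thesis by (simp only: Int_empty_left measure_empty)
    qed
    then show ?thesis by blast
  qed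
  also have "\<dots> \<longleftrightarrow> ?R"
  proof -
    have "(\<forall>A c. prob (?B A \<inter> ?K K c) * prob (?g (c g)) = prob (?B A \<inter> ?g (c g)) * prob (?K K c))
        \<longleftrightarrow> H (insert h K) + H {g} = H K + H {g, h}"
      if K: "finite K" "K \<subseteq> Q" "g \<in> K" for K
    proof -
      have KG: "K \<subseteq> carrier G" using K Q by blast
      \<comment> \<open>the label at \<open>g\<close> is the part that the pair and the labels on \<open>K\<close> have in common\<close>
      let ?Y = "\<lambda>x. (cell (T g x), cell (T h x))"
      have dY: "discrete_rv M ?Y" by (intro discrete_rv_Pair discrete_cell gG h)
      note dK = discrete_label[OF K(1) KG]
      have dh: "discrete_rv M (label (insert h K))" "discrete_rv M (label {g})" "discrete_rv M (label {g, h})"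
        using K KG gG h by (intro discrete_label; simp)+
      have lab: "label K x g = cell (T g x)" for x using K(3) by (simp add: label_def)
      have e1: "rv_entropy M (\<lambda>x. (?Y x, label K x)) = H (insert h K)"
      proof -
        have "rv_entropy M (\<lambda>x. (?Y x, label K x)) = rv_entropy M (label (insert h K))"
          using K(3) by (intro rv_entropy_cong discrete_rv_Pair dY dK dh) (auto simp: label_eq_iff)
        then show ?thesis using K KG h by (simp add: rv_entropy_label_H)
      qed
      have e2: "rv_entropy M (\<lambda>x. fst (?Y x)) = H {g}"
      proof -
        have "rv_entropy M (\<lambda>x. fst (?Y x)) = rv_entropy M (label {g})"
          by (intro rv_entropy_cong discrete_rv_comp[OF dY] dh) (simp add: label_eq_iff)
        then show ?thesis using gG by (simp add: rv_entropy_label_H)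
      qed
      have e3: "rv_entropy M ?Y = H {g, h}"
      proof -
        have "rv_entropy M ?Y = rv_entropy M (label {g, h})"
          by (intro rv_entropy_cong dY dh) (simp add: label_eq_iff)
        then show ?thesis using gG h by (simp add: rv_entropy_label_H)
      qed
      have e4: "rv_entropy M (label K) = H K" by (rule rv_entropy_label_H[OF K(1) KG])
      have "H (insert h K) + H {g} = H K + H {g, h} \<longleftrightarrow>
          rv_entropy M (\<lambda>x. (?Y x, label K x)) + rv_entropy M (\<lambda>x. fst (?Y x)) =
          rv_entropy M ?Y + rv_entropy M (label K)"
        unfolding e1 e2 e3 e4 ennreal_plus[OF H_nonneg H_nonneg, symmetric]
        using ennreal_inj[OF add_nonneg_nonneg[OF H_nonneg H_nonneg] add_nonneg_nonneg[OF H_nonneg H_nonneg]]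
        by (simp only: add.commute[of "H K"])
      also have "\<dots> \<longleftrightarrow> (\<forall>a b. fst a = b g \<longrightarrow>
          prob {x \<in> space M. ?Y x = a \<and> label K x = b} * prob {x \<in> space M. fst (?Y x) = fst a} =
          prob {x \<in> space M. ?Y x = a} * prob {x \<in> space M. label K x = b})"
        by (rule rv_entropy_eq_iff_cond_indep[OF dY dK]) (simp_all add: lab e3 e4)
      also have "\<dots> \<longleftrightarrow> (\<forall>A c. prob (?B A \<inter> ?K K c) * prob (?g (c g)) = prob (?B A \<inter> ?g (c g)) * prob (?K K c))"
      proof -
        have s1: "{x \<in> space M. ?Y x = (c g, A) \<and> label K x = c} = ?B A \<inter> ?K K c" for A c
          using lab by auto
        have s2: "{x \<in> space M. ?Y x = (c g, A)} = ?B A \<inter> ?g (c g)" for A c by auto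
        show ?thesis (is "?L' \<longleftrightarrow> ?R'")
        proof
          assume L': ?L'
          show ?R'
          proof (intro allI)
            fix A c
            show "prob (?B A \<inter> ?K K c) * prob (?g (c g)) = prob (?B A \<inter> ?g (c g)) * prob (?K K c)"
              using L'[THEN spec, of "(c g, A)", THEN spec, of c] unfolding s1 s2 fst_conv by (simp only: simp_thms)
          qed
        next
          assume R': ?R'
          show ?L'
          proof (intro allI impI)
            fix a :: "'x set \<times> 'x set" and b :: "'g \<Rightarrow> 'x set" assume ab: "fst a = b g"
            obtain A where a: "a = (b g, A)" using ab by (cases a) simp
            show "prob {x \<in> space M. ?Y x = a \<and> label K x = b} * prob {x \<in> space M. fst (?Y x) = fst a} =
                prob {x \<in> space M. ?Y x = a} * prob {x \<in> space M. label K x = b}"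
              unfolding a s1 s2 fst_conv by (rule R'[THEN spec, of A, THEN spec, of b])
          qed
        qed
      qed
      finally show ?thesis by (rule sym)
    qed
    then show ?thesis by (intro iff_allI imp_cong refl) (elim conjE)
  qed
  finally show ?thesis .
qed

end

section \<open>Reduced words\<close>

definition inv_letter :: "nat \<times> bool \<Rightarrow> nat \<times> bool" where
  "inv_letter l = (fst l, \<not> snd l)"

lemma inv_letter_simps [simp]:
  "inv_letter (inv_letter l) = l" "fst (inv_letter l) = fst l" "snd (inv_letter l) = (\<not> snd l)" "inv_letter (i, b) = (i, \<not> b)"
  by (auto simp: inv_letter_def)

lemma clash_iff: "fst k = fst l \<and> snd k \<noteq> snd l \<longleftrightarrow> k = inv_letter l"
  by (auto simp: inv_letter_def prod_eq_iff)

lemma reduced_simps: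
  "reduced []" "reduced [a]" "reduced (a # b # w) \<longleftrightarrow> a \<noteq> inv_letter b \<and> reduced (b # w)"
  unfolding reduced_def clash_iff by simp_all

lemma reduced_append_iff:
  "reduced (u @ v) \<longleftrightarrow> reduced u \<and> reduced v \<and> (u = [] \<or> v = [] \<or> last u \<noteq> inv_letter (hd v))"
  unfolding reduced_def clash_iff by (auto simp: successively_append_iff)

lemma reduced_Cons_iff: "reduced (a # w) \<longleftrightarrow> reduced w \<and> (w = [] \<or> a \<noteq> inv_letter (hd w))"
  using reduced_append_iff[of "[a]" w] by (auto simp: reduced_simps)

lemma reduced_snoc_iff: "reduced (w @ [a]) \<longleftrightarrow> reduced w \<and> (w = [] \<or> last w \<noteq> inv_letter a)"
  using reduced_append_iff[of w "[a]"] by (auto simp: reduced_simps)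

lemma reduced_map_inv_letter: "reduced (map inv_letter w) \<longleftrightarrow> reduced w"
  by (induction w rule: induct_list012) (auto simp: reduced_simps inv_letter_def prod_eq_iff)

lemma reduced_rev_map_inv_letter: "reduced w \<Longrightarrow> reduced (rev (map inv_letter w))"
proof (induction w)
  case (Cons a w)
  have "reduced (rev (map inv_letter w))" using Cons by (simp add: reduced_Cons_iff)
  moreover have "last (rev (map inv_letter w)) \<noteq> inv_letter (inv_letter a)" if "w \<noteq> []"
    using Cons.prems that by (auto simp: reduced_Cons_iff last_rev hd_map inv_letter_def prod_eq_iff)
  ultimately show ?case by (auto simp: reduced_snoc_iff)
qed (simp add: reduced_simps)

section \<open>Counting reduced words\<close>

text \<open>The set of signs is a parameter: all signs for the group and only \<open>True\<close> for the semigroup.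
In the latter case every word is reduced, so both cases share one treatment.\<close>

definition letters :: "nat \<Rightarrow> bool set \<Rightarrow> (nat \<times> bool) set" where
  "letters r Sg = {..<r} \<times> Sg"

definition red_words :: "nat \<Rightarrow> bool set \<Rightarrow> (nat \<times> bool) list set" where
  "red_words r Sg = {w \<in> lists (letters r Sg). reduced w}"

definition word_sphere :: "nat \<Rightarrow> bool set \<Rightarrow> nat \<Rightarrow> (nat \<times> bool) list set" where
  "word_sphere r Sg n = {w \<in> red_words r Sg. length w = n}"

definition ball_words :: "nat \<Rightarrow> bool set \<Rightarrow> nat \<Rightarrow> (nat \<times> bool) list set" where
  "ball_words r Sg n = {w \<in> red_words r Sg. length w \<le> n}"

definition sphere_ending :: "nat \<Rightarrow> bool set \<Rightarrow> nat \<Rightarrow> nat \<times> bool \<Rightarrow> (nat \<times> bool) list set" where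
  "sphere_ending r Sg n a = {w \<in> word_sphere r Sg (Suc n). last w = a}"

text \<open>The bound on the entropy gained when the vertex \<open>w\<close> is attached to its parent. It depends on the
generator that labels the edge, not on its sign.\<close>

definition weight :: "real \<Rightarrow> (nat \<Rightarrow> real) \<Rightarrow> (nat \<times> bool) list \<Rightarrow> real" where
  "weight c \<delta> w = (case w of [] \<Rightarrow> c | a # _ \<Rightarrow> \<delta> (fst a))"

definition tree_sum :: "real \<Rightarrow> (nat \<Rightarrow> real) \<Rightarrow> (nat \<times> bool) list set \<Rightarrow> real" where
  "tree_sum c \<delta> K = (\<Sum>w\<in>K. weight c \<delta> w)"

lemma finite_letters: "finite (letters r Sg)"
  unfolding letters_def by (intro finite_cartesian_product) (auto intro: finite_subset[of _ UNIV])

lemma finite_ball_words: "finite (ball_words r Sg n)"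
  by (rule finite_subset[OF _ finite_lists_length_le[OF finite_letters[of r Sg], of n]])
    (auto simp: ball_words_def red_words_def)

lemma sphere_subset_ball: "word_sphere r Sg n \<subseteq> ball_words r Sg n"
  by (auto simp: word_sphere_def ball_words_def)

lemma finite_sphere: "finite (word_sphere r Sg n)"
  by (rule finite_subset[OF sphere_subset_ball finite_ball_words])

lemma ball_words_Suc: "ball_words r Sg (Suc n) = ball_words r Sg n \<union> word_sphere r Sg (Suc n)"
  "ball_words r Sg n \<inter> word_sphere r Sg (Suc n) = {}"
  by (auto simp: ball_words_def word_sphere_def)

lemma ball_words_0: "ball_words r Sg 0 = {[]}"
  by (auto simp: ball_words_def red_words_def reduced_simps)

lemma tree_sum_ball_Suc:
  "tree_sum c \<delta> (ball_words r Sg (Suc n)) = tree_sum c \<delta> (ball_words r Sg n) + tree_sum c \<delta> (word_sphere r Sg (Suc n))"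
  unfolding tree_sum_def ball_words_Suc(1)
  by (rule sum.union_disjoint[OF finite_ball_words finite_sphere ball_words_Suc(2)])

lemma sphere_1: "word_sphere r Sg (Suc 0) = (\<lambda>a. [a]) ` letters r Sg"
  by (auto simp: word_sphere_def red_words_def length_Suc_conv reduced_simps)

lemma tree_sum_sphere_1:
  "tree_sum c \<delta> (word_sphere r Sg (Suc 0)) = real (card Sg) * (\<Sum>i<r. \<delta> i)"
proof -
  have "tree_sum c \<delta> (word_sphere r Sg (Suc 0)) = (\<Sum>a\<in>letters r Sg. \<delta> (fst a))"
    unfolding sphere_1 tree_sum_def by (subst sum.reindex) (auto simp: inj_on_def weight_def)
  also have "\<dots> = (\<Sum>i<r. \<Sum>b\<in>Sg. \<delta> i)"
    unfolding letters_def sum.cartesian_product by (intro sum.cong) auto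
  finally show ?thesis by (simp add: sum_distrib_left)
qed

lemma sphere_Suc:
  "word_sphere r Sg (Suc (Suc n)) =
    (\<lambda>(w, a). w @ [a]) ` (SIGMA w:word_sphere r Sg (Suc n). letters r Sg - {inv_letter (last w)})"
proof (intro equalityI subsetI)
  fix v assume v: "v \<in> word_sphere r Sg (Suc (Suc n))"
  then have "v \<noteq> []" by (auto simp: word_sphere_def)
  then obtain w a where va: "v = w @ [a]" using append_butlast_last_id by metis
  have "w \<in> word_sphere r Sg (Suc n)" "a \<in> letters r Sg - {inv_letter (last w)}"
    using v unfolding va by (auto simp: word_sphere_def red_words_def reduced_snoc_iff)
  then show "v \<in> (\<lambda>(w, a). w @ [a]) ` (SIGMA w:word_sphere r Sg (Suc n). letters r Sg - {inv_letter (last w)})"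
    using va by force
next
  fix v assume "v \<in> (\<lambda>(w, a). w @ [a]) ` (SIGMA w:word_sphere r Sg (Suc n). letters r Sg - {inv_letter (last w)})"
  then obtain w a where va: "v = w @ [a]" and w: "w \<in> word_sphere r Sg (Suc n)"
    and a: "a \<in> letters r Sg" "a \<noteq> inv_letter (last w)" by auto
  have "last w \<noteq> inv_letter a" using a(2) by (metis inv_letter_simps(1))
  then show "v \<in> word_sphere r Sg (Suc (Suc n))"
    using w a(1) unfolding va by (auto simp: word_sphere_def red_words_def reduced_snoc_iff)
qed

lemma card_letters_minus:
  assumes "Sg = UNIV \<or> Sg = {True}" "a \<in> letters r Sg"
  shows "real (card (letters r Sg - {inv_letter a})) = real (card Sg) * real r - real (card Sg) + 1"
  using assms(1)
proof
  assume Sg: "Sg = UNIV"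
  have "inv_letter a \<in> letters r Sg" using assms(2) Sg by (auto simp: letters_def inv_letter_def)
  moreover have "card (letters r Sg) = 2 * r"
    by (simp add: letters_def Sg card_cartesian_product card_UNIV_bool)
  moreover have "0 < r" using assms(2) by (auto simp: letters_def)
  ultimately show ?thesis
    by (simp add: card_Diff_singleton Sg card_UNIV_bool of_nat_diff)
next
  assume Sg: "Sg = {True}"
  have "inv_letter a \<notin> letters r Sg" using assms(2) Sg by (auto simp: letters_def inv_letter_def)
  then show ?thesis by (simp add: letters_def Sg card_cartesian_product)
qed

text \<open>Extending a nonempty word on the right keeps its first letter, hence its weight, and the number of
admissible last letters is the same for all words.\<close>

lemma tree_sum_sphere_Suc:
  assumes Sg: "Sg = UNIV \<or> Sg = {True}"
  shows "tree_sum c \<delta> (word_sphere r Sg (Suc (Suc n))) =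
    (real (card Sg) * real r - real (card Sg) + 1) * tree_sum c \<delta> (word_sphere r Sg (Suc n))"
proof -
  have fin: "finite (letters r Sg - A)" for A using finite_letters by auto
  have "tree_sum c \<delta> (word_sphere r Sg (Suc (Suc n))) =
      (\<Sum>(w, a)\<in>(SIGMA w:word_sphere r Sg (Suc n). letters r Sg - {inv_letter (last w)}). weight c \<delta> (w @ [a]))"
    unfolding tree_sum_def sphere_Suc by (subst sum.reindex) (auto simp: inj_on_def case_prod_beta)
  also have "\<dots> = (\<Sum>w\<in>word_sphere r Sg (Suc n). \<Sum>a\<in>letters r Sg - {inv_letter (last w)}. weight c \<delta> (w @ [a]))"
    using finite_sphere finite_letters by (intro sum.Sigma[symmetric]) auto
  also have "\<dots> = (\<Sum>w\<in>word_sphere r Sg (Suc n). (real (card Sg) * real r - real (card Sg) + 1) * weight c \<delta> w)"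
  proof (rule sum.cong[OF refl])
    fix w assume w: "w \<in> word_sphere r Sg (Suc n)"
    then have ne: "w \<noteq> []" by (auto simp: word_sphere_def)
    then have "weight c \<delta> (w @ [a]) = weight c \<delta> w" for a
      by (cases w) (auto simp: weight_def)
    moreover have "last w \<in> letters r Sg"
      using w ne by (auto simp: word_sphere_def red_words_def in_lists_conv_set)
    ultimately show "(\<Sum>a\<in>letters r Sg - {inv_letter (last w)}. weight c \<delta> (w @ [a])) =
        (real (card Sg) * real r - real (card Sg) + 1) * weight c \<delta> w"
      using card_letters_minus[OF Sg] by simp
  qed
  finally show ?thesis unfolding tree_sum_def by (simp add: sum_distrib_left)
qed

text \<open>In the group case positive and negative last letters contribute equally.\<close>

lemma tree_sum_sphere_ending:
  assumes Sg: "Sg = UNIV \<or> Sg = {True}"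
  shows "real (card Sg) * (\<Sum>i<r. tree_sum c \<delta> (sphere_ending r Sg n (i, True))) =
    tree_sum c \<delta> (word_sphere r Sg (Suc n))"
proof -
  let ?E = "sphere_ending r Sg n"
  have fin: "finite (?E a)" for a unfolding sphere_ending_def using finite_sphere by auto
  have "word_sphere r Sg (Suc n) = (\<Union>a\<in>letters r Sg. ?E a)"
  proof (intro equalityI subsetI)
    fix w assume w: "w \<in> word_sphere r Sg (Suc n)"
    then have "w \<noteq> []" by (auto simp: word_sphere_def)
    then have "last w \<in> letters r Sg" using w by (auto simp: word_sphere_def red_words_def in_lists_conv_set)
    then show "w \<in> (\<Union>a\<in>letters r Sg. ?E a)" using w by (auto simp: sphere_ending_def)
  qed (auto simp: sphere_ending_def)
  then have "tree_sum c \<delta> (word_sphere r Sg (Suc n)) = (\<Sum>a\<in>letters r Sg. tree_sum c \<delta> (?E a))"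
    unfolding tree_sum_def using fin finite_letters
    by (simp only:) (rule sum.UNION_disjoint, auto simp: sphere_ending_def)
  also have "\<dots> = (\<Sum>i<r. \<Sum>b\<in>Sg. tree_sum c \<delta> (?E (i, b)))"
    unfolding letters_def sum.cartesian_product by (intro sum.cong) auto
  also have "\<dots> = (\<Sum>i<r. real (card Sg) * tree_sum c \<delta> (?E (i, True)))"
    using Sg
  proof
    assume U: "Sg = UNIV"
    \<comment> \<open>inverting every letter is a weight-preserving involution of the sphere\<close>
    have "tree_sum c \<delta> (?E (i, False)) = tree_sum c \<delta> (?E (i, True))" for i
      unfolding tree_sum_def
    proof (rule sum.reindex_bij_witness[of _ "map inv_letter" "map inv_letter"])
      have ends: "map inv_letter w \<in> ?E (i, b)" if "w \<in> ?E (i, \<not> b)" for w b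
      proof -
        have "w \<noteq> []" using that by (auto simp: sphere_ending_def word_sphere_def)
        then show ?thesis
          using that U by (auto simp: sphere_ending_def word_sphere_def red_words_def letters_def
            reduced_map_inv_letter last_map in_lists_conv_set)
      qed
      show "map inv_letter w \<in> ?E (i, True)" if "w \<in> ?E (i, False)" for w using ends[of w True] that by simp
      show "map inv_letter w \<in> ?E (i, False)" if "w \<in> ?E (i, True)" for w using ends[of w False] that by simp
      show "weight c \<delta> (map inv_letter w) = weight c \<delta> w" for w
        by (cases w) (auto simp: weight_def)
    qed (simp_all add: o_def)
    then show ?thesis by (simp add: U UNIV_bool)
  qed simp
  finally show ?thesis by (simp add: sum_distrib_left)
qed

text \<open>This is \<open>F\<close> of the ball of radius \<open>n\<close> with the entropy replaced by the weight sum. Passing from \<open>n\<close>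
to \<open>n + 1\<close> changes the first term by \<open>1 - r\<close> times the weight of the new sphere, and the growth
rate of the spheres makes the second term compensate exactly.\<close>

lemma tree_sum_identity:
  assumes Sg: "Sg = UNIV \<or> Sg = {True}"
  shows "(1 - real r) * tree_sum c \<delta> (ball_words r Sg n) + (\<Sum>i<r. tree_sum c \<delta> (sphere_ending r Sg n (i, True)))
    = (1 - real r) * c + (\<Sum>i<r. \<delta> i)"
proof -
  let ?k = "real (card Sg)"
  have k: "0 < ?k" using Sg by (auto simp: card_UNIV_bool)
  have E: "(\<Sum>i<r. tree_sum c \<delta> (sphere_ending r Sg n (i, True))) = tree_sum c \<delta> (word_sphere r Sg (Suc n)) / ?k" for n
    using tree_sum_sphere_ending[OF Sg, where r=r and c=c and \<delta>=\<delta> and n=n]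
      nonzero_eq_divide_eq[OF less_imp_neq[OF k, symmetric]]
    by (simp only: mult.commute[of "?k"])
  show ?thesis
  proof (induction n)
    case 0
    show ?case unfolding E tree_sum_sphere_1 ball_words_0 using k by (auto simp: tree_sum_def weight_def)
  next
    case (Suc n)
    have "tree_sum c \<delta> (word_sphere r Sg (Suc (Suc n))) / ?k =
        tree_sum c \<delta> (word_sphere r Sg (Suc n)) / ?k - (1 - real r) * tree_sum c \<delta> (word_sphere r Sg (Suc n))"
    proof -
      have "(m * q - m + 1) * x / m = x / m - (1 - q) * x" if "0 < m" for m q x :: real
        using that by (simp add: field_simps)
      from this[OF k] show ?thesis unfolding tree_sum_sphere_Suc[OF Sg] .
    qed
    then show ?case using Suc unfolding E tree_sum_ball_Suc by (simp add: algebra_simps)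
  qed
qed

section \<open>The Cayley tree of reduced words\<close>

text \<open>What the free group and the free semigroup have in common: every element is represented by exactly
one reduced word, and letters cancel whenever both signs are present.\<close>

locale word_tree = monoid G
  for G :: "('g, 'b) monoid_scheme" (structure) and r :: nat and s :: "nat \<Rightarrow> 'g" and Sg :: "bool set" +
  assumes signs: "Sg = UNIV \<or> Sg = {True}"
    and letter_closed: "\<And>l. l \<in> letters r Sg \<Longrightarrow> letter G s l \<in> carrier G"
    and letter_inv_letter: "\<And>l. l \<in> letters r Sg \<Longrightarrow> inv_letter l \<in> letters r Sg \<Longrightarrow>
        letter G s l \<otimes> letter G s (inv_letter l) = \<one>"
    and words_generate: "\<And>g. g \<in> carrier G \<Longrightarrow>
        \<exists>u \<in> lists (letters r Sg). word_prod G (map (letter G s) u) = g"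
    and words_inj: "inj_on (\<lambda>w. word_prod G (map (letter G s) w)) (red_words r Sg)"
begin

definition ev :: "(nat \<times> bool) list \<Rightarrow> 'g" where
  "ev w = word_prod G (map (letter G s) w)"

abbreviation "\<Lambda> \<equiv> letters r Sg"
abbreviation "W \<equiv> red_words r Sg"

lemma ev_simps [simp]: "ev [] = \<one>" "ev (a # w) = letter G s a \<otimes> ev w"
  by (simp_all add: ev_def word_prod_def)

lemma ev_closed: "u \<in> lists \<Lambda> \<Longrightarrow> ev u \<in> carrier G"
  by (induction u) (auto intro: letter_closed)

lemma ev_append: "u \<in> lists \<Lambda> \<Longrightarrow> v \<in> lists \<Lambda> \<Longrightarrow> ev (u @ v) = ev u \<otimes> ev v"
  by (induction u) (auto simp: ev_closed letter_closed m_assoc)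

lemma W_lists: "w \<in> W \<Longrightarrow> w \<in> lists \<Lambda>"
  by (simp add: red_words_def)

lemma ev_W_closed: "w \<in> W \<Longrightarrow> ev w \<in> carrier G"
  by (rule ev_closed[OF W_lists])

lemma ev_inj: "v \<in> W \<Longrightarrow> w \<in> W \<Longrightarrow> ev v = ev w \<Longrightarrow> v = w"
  using words_inj unfolding ev_def by (rule inj_onD) auto

lemma inj_on_ev: "inj_on ev W"
  by (rule inj_onI) (rule ev_inj)

lemma Nil_in_W: "[] \<in> W"
  by (simp add: red_words_def reduced_simps)

lemma W_suffix: "u @ v \<in> W \<Longrightarrow> v \<in> W"
  by (auto simp: red_words_def reduced_append_iff)

lemma W_tail: "a # w \<in> W \<Longrightarrow> w \<in> W"
  using W_suffix[of "[a]" w] by simp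

lemma W_head: "a # w \<in> W \<Longrightarrow> a \<in> \<Lambda>"
  by (auto simp: red_words_def)

text \<open>Multiplying by a letter on the left either extends the reduced word or removes its first letter, so it
moves to a child or to the parent in the tree.\<close>

lemma letter_step:
  assumes w: "w \<in> W" and a: "a \<in> \<Lambda>"
  obtains (extend) "a # w \<in> W" | (cancel) v where "w = inv_letter a # v" "v \<in> W" "letter G s a \<otimes> ev w = ev v"
proof (cases "a # w \<in> W")
  case False
  then have "\<not> reduced (a # w)" using w a by (simp add: red_words_def)
  then obtain v where v: "w = inv_letter a # v"
    using w by (cases w) (auto simp: red_words_def reduced_Cons_iff)
  have vW: "v \<in> W" using W_tail w unfolding v .
  have "inv_letter a \<in> \<Lambda>" using W_head w unfolding v .
  then have "letter G s a \<otimes> ev w = ev v"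
    using a letter_inv_letter letter_closed ev_W_closed[OF vW] unfolding v
    by (simp add: m_assoc[symmetric])
  then show ?thesis using v vW cancel by blast
qed (rule extend)

lemma reduce_word: "u \<in> lists \<Lambda> \<Longrightarrow> \<exists>w\<in>W. ev w = ev u \<and> length w \<le> length u"
proof (induction u)
  case Nil
  then show ?case using Nil_in_W by force
next
  case (Cons a u)
  then obtain w where w: "w \<in> W" "ev w = ev u" "length w \<le> length u" by auto
  have a: "a \<in> \<Lambda>" using Cons.prems by simp
  show ?case
    using w(1) a
  proof (cases rule: letter_step)
    case extend
    then show ?thesis using w by (intro bexI[of _ "a # w"]) simp_all
  next
    case (cancel v)
    then show ?thesis using w by (intro bexI[of _ v]) simp_all
  qed
qed

lemma ev_surj: "g \<in> carrier G \<Longrightarrow> \<exists>w\<in>W. ev w = g"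
  using words_generate[of g] reduce_word unfolding ev_def by metis

lemma word_length_ev:
  assumes w: "w \<in> W"
  shows "word_length G (letter G s ` \<Lambda>) (ev w) = length w"
  unfolding word_length_def
proof (rule Least_equality)
  show "\<exists>v\<in>lists (letter G s ` \<Lambda>). length v = length w \<and> word_prod G v = ev w"
    using W_lists[OF w] by (intro bexI[of _ "map (letter G s) w"]) (auto simp: ev_def)
next
  fix n assume "\<exists>v\<in>lists (letter G s ` \<Lambda>). length v = n \<and> word_prod G v = ev w"
  then obtain v where v: "v \<in> lists (letter G s ` \<Lambda>)" "length v = n" "word_prod G v = ev w" by blast
  then obtain u where u: "u \<in> lists \<Lambda>" "v = map (letter G s) u"
    unfolding lists_image by blast
  then obtain w' where "w' \<in> W" "ev w' = ev u" "length w' \<le> length u"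
    using reduce_word by blast
  moreover have "ev u = ev w" using u v by (simp add: ev_def)
  ultimately show "length w \<le> n" using ev_inj[of w' w] w u v by auto
qed

lemma word_ball_eq: "word_ball G (letter G s ` \<Lambda>) n = ev ` ball_words r Sg n"
  unfolding word_ball_def ball_words_def
  using word_length_ev ev_surj ev_W_closed by (auto simp: image_iff) metis

lemma ev_snoc: "w \<in> lists \<Lambda> \<Longrightarrow> a \<in> \<Lambda> \<Longrightarrow> ev (w @ [a]) = ev w \<otimes> letter G s a"
  by (simp add: ev_append letter_closed)

lemma ball_translate_subset:
  assumes a: "a \<in> \<Lambda>"
  shows "(\<lambda>k. k \<otimes> letter G s a) ` ev ` ball_words r Sg n \<subseteq> ev ` ball_words r Sg (Suc n)"
proof (clarify)
  fix w assume w: "w \<in> ball_words r Sg n"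
  then have wl: "w \<in> lists \<Lambda>" "length w \<le> n" by (auto simp: ball_words_def red_words_def)
  then obtain v where "v \<in> W" "ev v = ev (w @ [a])" "length v \<le> length (w @ [a])"
    using reduce_word[of "w @ [a]"] a by auto
  then show "ev w \<otimes> letter G s a \<in> ev ` ball_words r Sg (Suc n)"
    using wl a by (auto simp: ev_snoc ball_words_def intro!: image_eqI[of _ _ v])
qed

text \<open>Multiplying a word of length \<open>n\<close> by a letter on the right either cancels or gives a word of length
\<open>n + 1\<close> with that last letter. In tree terms the union is the ball with some leaves attached.\<close>

lemma ball_Un_translate:
  assumes a: "a \<in> \<Lambda>"
  shows "ev ` ball_words r Sg n \<union> (\<lambda>k. k \<otimes> letter G s a) ` ev ` ball_words r Sg n =
    ev ` (ball_words r Sg n \<union> sphere_ending r Sg n a)"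
proof (intro equalityI subsetI)
  fix g assume "g \<in> ev ` ball_words r Sg n \<union> (\<lambda>k. k \<otimes> letter G s a) ` ev ` ball_words r Sg n"
  then consider "g \<in> ev ` ball_words r Sg n"
    | w where "w \<in> ball_words r Sg n" "g = ev w \<otimes> letter G s a" by auto
  then show "g \<in> ev ` (ball_words r Sg n \<union> sphere_ending r Sg n a)"
  proof cases
    case 2
    then have w: "w \<in> W" "length w \<le> n" by (auto simp: ball_words_def)
    have g: "g = ev (w @ [a])" using 2 w a W_lists by (simp add: ev_snoc)
    show ?thesis
    proof (cases "w @ [a] \<in> W")
      case True
      then have "w @ [a] \<in> ball_words r Sg n \<union> sphere_ending r Sg n a"
        using w by (auto simp: ball_words_def sphere_ending_def word_sphere_def)
      then show ?thesis using g by blast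
    next
      case False
      then have "w \<noteq> []" "last w = inv_letter a"
        using w a by (auto simp: red_words_def reduced_snoc_iff)
      then obtain v where v: "w = v @ [inv_letter a]" by (metis append_butlast_last_id)
      have vW: "v \<in> W" using w(1) unfolding v by (auto simp: red_words_def reduced_append_iff)
      have ba: "inv_letter a \<in> \<Lambda>" using w(1) unfolding v by (auto simp: red_words_def)
      have "g = ev v \<otimes> (letter G s (inv_letter a) \<otimes> letter G s a)"
        using 2(2) ba a vW W_lists unfolding v by (simp add: ev_snoc m_assoc letter_closed ev_closed)
      also have "letter G s (inv_letter a) \<otimes> letter G s a = \<one>" using letter_inv_letter[OF ba] a by simp
      finally have "g = ev v" using ev_W_closed[OF vW] by simp
      moreover have "v \<in> ball_words r Sg n" using w vW unfolding v by (simp add: ball_words_def)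
      ultimately show ?thesis by blast
    qed
  qed auto
next
  fix g assume "g \<in> ev ` (ball_words r Sg n \<union> sphere_ending r Sg n a)"
  then consider "g \<in> ev ` ball_words r Sg n" | v where "v \<in> sphere_ending r Sg n a" "g = ev v" by auto
  then show "g \<in> ev ` ball_words r Sg n \<union> (\<lambda>k. k \<otimes> letter G s a) ` ev ` ball_words r Sg n"
  proof cases
    case 2
    then have "v \<noteq> []" "last v = a" "v \<in> W" "length v = Suc n"
      by (auto simp: sphere_ending_def word_sphere_def)
    then obtain w where v: "v = w @ [a]" by (metis append_butlast_last_id)
    have "w \<in> ball_words r Sg n"
      using \<open>v \<in> W\<close> \<open>length v = Suc n\<close> unfolding v by (auto simp: ball_words_def red_words_def reduced_append_iff)
    moreover have "g = ev w \<otimes> letter G s a"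
      using \<open>v \<in> W\<close> 2(2) a unfolding v by (simp add: ev_snoc red_words_def)
    ultimately show ?thesis by blast
  qed auto
qed

subsection \<open>The past in the left Cayley tree\<close>

abbreviation "S \<equiv> letter G s ` \<Lambda>"

lemma edge_tail:
  assumes "left_cayley_edge G S (ev u) (ev v)" "u \<in> W" "v \<in> W"
  shows "\<exists>b. v = b # u \<or> u = b # v"
proof -
  obtain a where a: "a \<in> \<Lambda>" "ev v = letter G s a \<otimes> ev u"
    using assms(1) unfolding left_cayley_edge_def by blast
  show ?thesis
    using assms(2) a(1)
  proof (cases rule: letter_step)
    case extend
    then have "v = a # u" using a assms by (intro ev_inj) simp_all
    then show ?thesis by blast
  next
    case (cancel w)
    then have "v = w" using a assms by (intro ev_inj) simp_all
    then show ?thesis using cancel by blast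
  qed
qed

text \<open>The words with suffix \<open>a # w\<close> are the descendants of that vertex; an edge enters this set only from
\<open>w\<close>, because consecutive vertices on a path are parent and child.\<close>

lemma path_crosses_parent:
  assumes "cayley_path G S (ev v) p (ev y)" "v \<in> W" "y \<in> W" "\<not> suffix (a # w) v" "suffix (a # w) y"
  shows "ev w \<in> set p"
  using assms
proof (induction p arbitrary: v)
  case Nil
  then show ?case by (simp add: cayley_path_def)
next
  case (Cons f p)
  have f: "f = ev v" using Cons.prems(1) by (simp add: cayley_path_def)
  show ?case
  proof (cases p)
    case Nil
    then have "ev v = ev y" using Cons.prems(1) by (auto simp: cayley_path_def)
    then have "v = y" using Cons.prems ev_inj by blast
    then show ?thesis using Cons.prems by blast
  next
    case (Cons f' p')
    have path: "f' \<in> carrier G" "left_cayley_edge G S (ev v) f' \<or> left_cayley_edge G S f' (ev v)"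
      "cayley_path G S f' p (ev y)"
      using Cons.prems(1) unfolding Cons f by (auto simp: cayley_path_def)
    obtain u where u: "u \<in> W" "ev u = f'" using ev_surj path(1) by blast
    show ?thesis
    proof (cases "suffix (a # w) u")
      case True
      obtain b where "u = b # v \<or> v = b # u"
        using path(2) edge_tail u Cons.prems(2) by metis
      then have "u = b # v" using True Cons.prems(4) suffix_ConsI by metis
      then have "a # w = b # v" using True Cons.prems(4) by (simp add: suffix_Cons)
      then show ?thesis using f by simp
    next
      case False
      then show ?thesis using Cons.IH[of u] path(3) u Cons.prems by simp
    qed
  qed
qed

text \<open>The path that strips first letters one by one stays among the descendants of \<open>x\<close>.\<close>

lemma path_to_ancestor:
  "u @ x \<in> W \<Longrightarrow> \<exists>p. cayley_path G S (ev (u @ x)) p (ev x) \<and> (\<forall>g\<in>set p. \<exists>v. v @ x \<in> W \<and> g = ev (v @ x))"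
proof (induction u)
  case Nil
  then show ?case
    by (intro exI[of _ "[ev x]"]) (auto simp: cayley_path_def ev_W_closed intro: exI[of _ "[]"])
next
  case (Cons b u)
  have uW: "u @ x \<in> W" using Cons.prems W_tail by simp
  obtain p where p: "cayley_path G S (ev (u @ x)) p (ev x)" "\<forall>g\<in>set p. \<exists>v. v @ x \<in> W \<and> g = ev (v @ x)"
    using Cons.IH[OF uW] by blast
  have "left_cayley_edge G S (ev (u @ x)) (ev ((b # u) @ x))"
    unfolding left_cayley_edge_def using ev_W_closed[OF uW] W_head[of b "u @ x"] Cons.prems by auto
  then have "cayley_path G S (ev ((b # u) @ x)) (ev ((b # u) @ x) # p) (ev x)"
    using p(1) ev_W_closed[OF Cons.prems] unfolding cayley_path_def
    by (cases p) auto
  moreover have "\<forall>g\<in>set (ev ((b # u) @ x) # p). \<exists>v. v @ x \<in> W \<and> g = ev (v @ x)"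
    using p(2) Cons.prems by (metis set_ConsD)
  ultimately show ?case by blast
qed

lemma Past_parent:
  assumes aw: "a # w \<in> W"
  shows "Past G S (ev (a # w)) (ev w) = ev ` {v \<in> W. \<not> suffix (a # w) v}"
proof (intro equalityI subsetI)
  fix f assume f: "f \<in> Past G S (ev (a # w)) (ev w)"
  then have "f \<in> carrier G" by (simp add: Past_def)
  then obtain v where v: "v \<in> W" "f = ev v" using ev_surj by blast
  have "\<not> suffix (a # w) v"
  proof
    assume "suffix (a # w) v"
    then obtain u where u: "v = u @ a # w" by (auto simp: suffix_def)
    obtain p where p: "cayley_path G S f p (ev (a # w))"
      "\<forall>g\<in>set p. \<exists>v. v @ a # w \<in> W \<and> g = ev (v @ a # w)"
      using path_to_ancestor[of u "a # w"] v unfolding u by blast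
    then have "ev w \<in> set p" using f unfolding Past_def by blast
    then obtain v' where v': "v' @ a # w \<in> W" "ev w = ev (v' @ a # w)" using p(2) by blast
    then have "w = v' @ a # w" using W_tail[OF aw] by (intro ev_inj)
    then have "length w = length (v' @ a # w)" by simp
    then show False by simp
  qed
  then show "f \<in> ev ` {v \<in> W. \<not> suffix (a # w) v}" using v by blast
next
  fix f assume "f \<in> ev ` {v \<in> W. \<not> suffix (a # w) v}"
  then obtain v where "v \<in> W" "f = ev v" "\<not> suffix (a # w) v" by blast
  then show "f \<in> Past G S (ev (a # w)) (ev w)"
    unfolding Past_def using path_crosses_parent[of v _ "a # w"] aw ev_W_closed by auto
qed

end

section \<open>Free groups and free semigroups\<close>

lemma (in monoid) word_prod_append:
  "u \<in> lists (carrier G) \<Longrightarrow> v \<in> lists (carrier G) \<Longrightarrow>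
    word_prod G u \<in> carrier G \<and> word_prod G v \<in> carrier G \<and>
    word_prod G (u @ v) = word_prod G u \<otimes> word_prod G v"
proof (induction u)
  case Nil
  have "word_prod G v \<in> carrier G" using Nil(2) by (induction v) (auto simp: word_prod_def)
  then show ?case by (simp add: word_prod_def)
next
  case (Cons a u)
  then show ?case by (simp add: word_prod_def m_assoc)
qed

text \<open>If two reduced words with different first letters had the same value, the inverse of one followed by
the other would be a nonempty reduced word representing the identity.\<close>

lemma free_group_word_tree:
  fixes G (structure)
  assumes "free_group_on G r s"
  shows "word_tree G r s UNIV"
proof -
  interpret group G using assms by (simp add: free_group_on_def)
  have s: "s i \<in> carrier G" if "i < r" for i
    using assms that by (auto simp: free_group_on_def)
  have gen: "generate G (s ` {..<r}) = carrier G"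
    and free: "\<And>w. w \<in> lists ({..<r} \<times> UNIV) \<Longrightarrow> reduced w \<Longrightarrow> w \<noteq> [] \<Longrightarrow>
        word_prod G (map (letter G s) w) \<noteq> \<one>"
    using assms by (auto simp: free_group_on_def)
  let ?L = "letters r UNIV"
  let ?p = "\<lambda>w. word_prod G (map (letter G s) w)"
  have letter: "letter G s l \<in> carrier G" if "l \<in> ?L" for l
    using that s by (auto simp: letters_def letter_def)
  have letter_inv_letter: "letter G s l \<otimes> letter G s (inv_letter l) = \<one>" if "l \<in> ?L" for l
    using that s by (auto simp: letters_def letter_def inv_letter_def)
  have inv_letter: "inv_letter l \<in> ?L" if "l \<in> ?L" for l
    using that by (auto simp: letters_def)
  have lists: "map (letter G s) w \<in> lists (carrier G)" if "w \<in> lists ?L" for w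
    using that letter by auto
  have closed: "?p w \<in> carrier G" if "w \<in> lists ?L" for w
    using word_prod_append[of "map (letter G s) w" "[]"] lists[OF that] by simp
  have append: "?p (u @ v) = ?p u \<otimes> ?p v" if "u \<in> lists ?L" "v \<in> lists ?L" for u v
    using word_prod_append[OF lists[OF that(1)] lists[OF that(2)]] by simp
  have Cons: "?p (a # u) = letter G s a \<otimes> ?p u" for a u
    by (simp add: word_prod_def)
  have single: "?p [a] = letter G s a" if "a \<in> ?L" for a
    using letter[OF that] by (simp add: word_prod_def)
  have word_inverse_lists: "rev (map inv_letter u) \<in> lists ?L" if "u \<in> lists ?L" for u
    using that inv_letter by (auto simp: in_lists_conv_set)
  have inverse: "?p (rev (map inv_letter u)) \<otimes> ?p u = \<one>" if "u \<in> lists ?L" for u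
    using that
  proof (induction u)
    case (Cons a u)
    then have a: "a \<in> ?L" and u: "u \<in> lists ?L" by auto
    have "?p (rev (map inv_letter (a # u))) = ?p (rev (map inv_letter u)) \<otimes> letter G s (inv_letter a)"
      using append[OF word_inverse_lists[OF u], of "[inv_letter a]"] inv_letter[OF a] single[OF inv_letter[OF a]] by simp
    then have "?p (rev (map inv_letter (a # u))) \<otimes> ?p (a # u) =
        ?p (rev (map inv_letter u)) \<otimes> (letter G s (inv_letter a) \<otimes> (letter G s a \<otimes> ?p u))"
      unfolding \<open>?p (a # u) = letter G s a \<otimes> ?p u\<close>
      using closed[OF word_inverse_lists[OF u]] closed[OF u] letter a inv_letter[OF a] by (simp add: m_assoc)
    also have "letter G s (inv_letter a) \<otimes> (letter G s a \<otimes> ?p u) = ?p u"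
      using letter_inv_letter[OF inv_letter[OF a]] closed[OF u] letter a inv_letter[OF a] by (simp add: m_assoc[symmetric])
    finally show ?case using Cons.IH u by simp
  qed (simp add: word_prod_def)
  have nontrivial: "w = []" if "w \<in> red_words r UNIV" "?p w = \<one>" for w
    using free[of w] that by (auto simp: red_words_def letters_def)
  have red_tail: "w \<in> red_words r UNIV" "a \<in> ?L" if "a # w \<in> red_words r UNIV" for a w
    using that by (auto simp: red_words_def reduced_Cons_iff)
  have inj: "u = v" if "u \<in> red_words r UNIV" "v \<in> red_words r UNIV" "?p u = ?p v" for u v
    using that
  proof (induction u arbitrary: v)
    case Nil
    then show ?case using nontrivial[of v] by (simp add: word_prod_def)
  next
    case (Cons a u)
    show ?case
    proof (cases v)
      case Nil
      then show ?thesis using Cons.prems nontrivial[of "a # u"] by (simp add: word_prod_def)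
    next
      case (Cons b v')
      have au: "a # u \<in> lists ?L" "reduced (a # u)" and bv: "b # v' \<in> lists ?L" "reduced (b # v')"
        using Cons.prems Cons by (auto simp: red_words_def)
      show ?thesis
      proof (cases "a = b")
        case True
        have "letter G s a \<otimes> ?p u = letter G s a \<otimes> ?p v'"
          using Cons.prems(3) unfolding Cons True by (simp add: word_prod_def)
        then have "?p u = ?p v'" 
          using Units_l_cancel[of "letter G s a" "?p u" "?p v'"] letter[of a] closed[of u] closed[of v'] au(1) bv(1)
          by simp
        then show ?thesis
          using Cons.IH[of v'] Cons.prems red_tail(1) unfolding Cons True by blast
      next
        case False
        \<comment> \<open>the concatenation of the inverse word with v is reduced, so it cannot represent the identity\<close>
        let ?x = "rev (map inv_letter (a # u)) @ b # v'"
        have "inv_letter a \<noteq> inv_letter b" using False by (metis inv_letter_simps(1))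
        then have "reduced ?x"
          using reduced_rev_map_inv_letter[OF au(2)] bv(2) by (subst reduced_append_iff) simp
        then have "?x \<in> red_words r UNIV" using word_inverse_lists[OF au(1)] bv(1) by (simp add: red_words_def)
        moreover have "?p ?x = \<one>"
          using append[OF word_inverse_lists[OF au(1)] bv(1)] inverse[OF au(1)] Cons.prems(3) unfolding Cons by simp
        ultimately show ?thesis using nontrivial[of ?x] by simp
      qed
    qed
  qed
  show ?thesis
  proof (unfold_locales)
    show "inj_on ?p (red_words r UNIV)" using inj by (rule inj_onI)
    fix g assume "g \<in> carrier G"
    then have "g \<in> generate G (s ` {..<r})" using gen by simp
    then show "\<exists>u\<in>lists ?L. ?p u = g"
    proof (induction rule: generate.induct)
      case one
      show ?case by (intro bexI[of _ "[]"]) (simp_all add: word_prod_def)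
    next
      case (incl h)
      then obtain i where "i < r" "h = s i" by auto
      then show ?case using s
        by (intro bexI[of _ "[(i, True)]"]) (auto simp: word_prod_def letters_def letter_def)
    next
      case (inv h)
      then obtain i where "i < r" "h = s i" by auto
      then show ?case using s
        by (intro bexI[of _ "[(i, False)]"]) (auto simp: word_prod_def letters_def letter_def)
    next
      case (eng h1 h2)
      then obtain u v where "u \<in> lists ?L" "?p u = h1" "v \<in> lists ?L" "?p v = h2" by blast
      then show ?case using append by (intro bexI[of _ "u @ v"]) auto
    qed
  qed (use letter letter_inv_letter in auto)
qed

lemma free_semigroup_word_tree:
  fixes G (structure)
  assumes "free_semigroup_on G r s"
  shows "word_tree G r s {True}"
proof -
  interpret monoid G using assms by (simp add: free_semigroup_on_def)
  have s: "s i \<in> carrier G" if "i < r" for i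
    using assms that by (auto simp: free_semigroup_on_def)
  have bij: "bij_betw (\<lambda>w. word_prod G (map s w)) (lists {..<r}) (carrier G)"
    using assms by (simp add: free_semigroup_on_def)
  let ?L = "letters r {True}"
  let ?p = "\<lambda>w. word_prod G (map (letter G s) w)"
  have map_fst: "map (letter G s) w = map s (map fst w)" if "w \<in> lists ?L" for w
    using that by (auto simp: letters_def letter_def)
  have fst_lists: "map fst w \<in> lists {..<r}" if "w \<in> lists ?L" for w
    using that by (induction w) (auto simp: letters_def)
  have relabel: "w = map (\<lambda>i. (i, True)) (map fst w)" if "w \<in> lists ?L" for w
    using that by (induction w) (auto simp: letters_def)
  show ?thesis
  proof (unfold_locales)
    show "inj_on ?p (red_words r {True})"
    proof (rule inj_onI)
      fix u v assume u: "u \<in> red_words r {True}" and v: "v \<in> red_words r {True}" and eq: "?p u = ?p v"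
      have L: "u \<in> lists ?L" "v \<in> lists ?L" using u v by (auto simp: red_words_def)
      have "word_prod G (map s (map fst u)) = word_prod G (map s (map fst v))"
        using eq by (simp only: map_fst[OF L(1)] map_fst[OF L(2)])
      then have "map fst u = map fst v"
        by (rule inj_onD[OF bij_betw_imp_inj_on[OF bij] _ fst_lists[OF L(1)] fst_lists[OF L(2)]])
      then show "u = v" using relabel[OF L(1)] relabel[OF L(2)] by metis
    qed
    fix g assume "g \<in> carrier G"
    then have "g \<in> (\<lambda>w. word_prod G (map s w)) ` lists {..<r}"
      unfolding bij_betw_imp_surj_on[OF bij] .
    then obtain w where w: "w \<in> lists {..<r}" "word_prod G (map s w) = g" by blast
    have "map (\<lambda>i. (i, True)) w \<in> lists ?L" using w(1) by (auto simp: letters_def)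
    moreover have "map (letter G s) (map (\<lambda>i. (i, True)) w) = map s w"
      by (simp add: letter_def)
    ultimately show "\<exists>u\<in>lists ?L. ?p u = g" using w(2) by metis
  qed (use s in \<open>auto simp: letters_def letter_def inv_letter_def\<close>)
qed

section \<open>Entropy on the tree\<close>

locale labelled_tree = labelled_action G T M \<alpha> + word_tree G r s Sg
  for G :: "('g, 'b) monoid_scheme" (structure) and T :: "'g \<Rightarrow> 'x \<Rightarrow> 'x"
    and M :: "'x measure" and \<alpha> :: "'x set set" and r :: nat and s :: "nat \<Rightarrow> 'g" and Sg :: "bool set"
begin

definition word_entropy :: "(nat \<times> bool) list set \<Rightarrow> real" where
  "word_entropy K = H (ev ` K)"

definition edge_gain :: "nat \<Rightarrow> real" where
  "edge_gain i = H {\<one>, s i} - H {\<one>}"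

abbreviation \<Phi> :: "(nat \<times> bool) list set \<Rightarrow> real" where
  "\<Phi> \<equiv> tree_sum (H {\<one>}) edge_gain"

abbreviation ball :: "nat \<Rightarrow> (nat \<times> bool) list set" where
  "ball \<equiv> ball_words r Sg"

text \<open>The leaves by which the union of a ball and its translate by a generator exceeds the ball.\<close>

abbreviation bud :: "nat \<Rightarrow> nat \<Rightarrow> (nat \<times> bool) list set" where
  "bud n i \<equiv> sphere_ending r Sg n (i, True)"

definition subtree :: "(nat \<times> bool) list set \<Rightarrow> bool" where
  "subtree K \<longleftrightarrow> finite K \<and> K \<subseteq> W \<and> [] \<in> K \<and> (\<forall>a w. a # w \<in> K \<longrightarrow> w \<in> K)"

definition tree_additive :: bool where
  "tree_additive \<longleftrightarrow> (\<forall>K. subtree K \<longrightarrow> word_entropy K = \<Phi> K)"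

text \<open>The Markov condition at the edge from \<open>g\<close> to \<open>t g\<close>, stated with entropies.\<close>

definition past_determined :: "'g \<Rightarrow> 'g \<Rightarrow> bool" where
  "past_determined t g \<longleftrightarrow> (\<forall>K. finite K \<and> K \<subseteq> Past G S (t \<otimes> g) g \<and> g \<in> K \<longrightarrow>
     H (insert (t \<otimes> g) K) + H {g} = H K + H {g, t \<otimes> g})"

lemma letter_plus: "i < r \<Longrightarrow> (i, True) \<in> \<Lambda>" "letter G s (i, True) = s i"
  using signs by (auto simp: letters_def letter_def)

lemma s_closed: "i < r \<Longrightarrow> s i \<in> carrier G"
  using letter_closed letter_plus by metis

lemma ev_image_closed: "K \<subseteq> W \<Longrightarrow> ev ` K \<subseteq> carrier G"
  using ev_W_closed by blast

subsection \<open>Entropy of edges\<close>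

lemma H_single: "g \<in> carrier G \<Longrightarrow> H {g} = H {\<one>}"
  using H_translate[of g "{\<one>}"] by simp

text \<open>Any edge is a right translate of the edge from the identity to a generator. For an inverse generator
the roles of the two endpoints are exchanged.\<close>

lemma H_edge:
  assumes aw: "a # w \<in> W"
  shows "H {ev w, ev (a # w)} = H {\<one>} + edge_gain (fst a)"
proof -
  have a: "a \<in> \<Lambda>" and w: "ev w \<in> carrier G" using W_head[OF aw] ev_W_closed[OF W_tail[OF aw]] .
  obtain i b where ib: "a = (i, b)" by (cases a)
  have i: "i < r" using a ib by (simp add: letters_def)
  show ?thesis
  proof (cases b)
    case True
    have "H {ev w, ev (a # w)} = H ((\<lambda>k. k \<otimes> ev w) ` {\<one>, s i})"
      using w ib True letter_plus(2) by simp
    also have "\<dots> = H {\<one>, s i}" using w s_closed[OF i] by (intro H_translate) auto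
    finally show ?thesis by (simp add: edge_gain_def ib)
  next
    case False
    have aw': "ev (a # w) \<in> carrier G" by (rule ev_W_closed[OF aw])
    have "s i \<otimes> letter G s a = \<one>"
      using letter_inv_letter[OF letter_plus(1)[OF i]] a letter_plus(2) unfolding ib using False by simp
    then have "s i \<otimes> ev (a # w) = ev w"
      using w s_closed[OF i] letter_closed[OF a] by (simp add: m_assoc[symmetric])
    then have "H {ev w, ev (a # w)} = H ((\<lambda>k. k \<otimes> ev (a # w)) ` {s i, \<one>})"
      using aw' by (simp only: image_insert image_empty l_one)
    also have "\<dots> = H {s i, \<one>}" using aw' s_closed[OF i] by (intro H_translate) auto
    finally show ?thesis by (simp add: edge_gain_def ib insert_commute)
  qed
qed

lemma word_entropy_submodular:
  assumes "finite K" "K \<subseteq> W" "finite L" "L \<subseteq> W" "C \<subseteq> K" "C \<subseteq> L"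
  shows "word_entropy (K \<union> L) + word_entropy C \<le> word_entropy K + word_entropy L"
  unfolding word_entropy_def image_Un using assms
  by (intro H_submodular finite_imageI ev_image_closed image_mono)

text \<open>Strong subadditivity for the tree and the new edge, which share the vertex \<open>w\<close>.\<close>

lemma word_entropy_leaf_le:
  assumes "finite K" "K \<subseteq> W" "w \<in> K" "a # w \<in> W"
  shows "word_entropy (insert (a # w) K) \<le> word_entropy K + edge_gain (fst a)"
proof -
  have "word_entropy (K \<union> {w, a # w}) + word_entropy {w} \<le> word_entropy K + word_entropy {w, a # w}"
    using assms by (intro word_entropy_submodular) auto
  moreover have "K \<union> {w, a # w} = insert (a # w) K" using assms by blast
  moreover have "word_entropy {w, a # w} = H {\<one>} + edge_gain (fst a)"
    using H_edge[OF assms(4)] by (simp add: word_entropy_def)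
  moreover have "word_entropy {w} = H {\<one>}" 
    using H_single[OF ev_W_closed[of w]] assms(2,3) by (auto simp: word_entropy_def)
  ultimately show ?thesis by simp
qed

subsection \<open>Subtrees\<close>

lemma subtree_grow_induct [consumes 3, case_names base grow]:
  assumes "subtree K" "subtree L" "K \<subseteq> L" "P K"
    and grow: "\<And>N a w. subtree N \<Longrightarrow> w \<in> N \<Longrightarrow> a # w \<in> L \<Longrightarrow> a # w \<notin> N \<Longrightarrow> P N \<Longrightarrow> P (insert (a # w) N)"
  shows "P L"
  using assms(1-4)
proof (induction "card (L - K)" arbitrary: K)
  case 0
  then have "L = K" by (auto simp: subtree_def)
  then show ?case using 0 by simp
next
  case (Suc n)
  have "card (L - K) \<noteq> 0" using Suc.hyps(2) by simp
  then have fin: "finite (L - K)" and ne: "L - K \<noteq> {}" unfolding card_eq_0_iff by blast+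
  \<comment> \<open>a shortest word outside the smaller tree hangs off it\<close>
  obtain v where v: "v \<in> L - K" "\<And>u. u \<in> L - K \<Longrightarrow> length v \<le> length u"
    using arg_min_if_finite[OF fin ne, of length] by (metis not_le)
  have "v \<noteq> []" using v(1) Suc.prems(1) by (auto simp: subtree_def)
  then obtain a w where aw: "v = a # w" by (cases v) auto
  have wL: "w \<in> L" using v(1) Suc.prems(2) unfolding aw subtree_def by blast
  have wK: "w \<in> K" using v(2)[of w] wL unfolding aw by fastforce
  have sub: "subtree (insert (a # w) K)"
    using Suc.prems wK v(1) unfolding subtree_def aw by auto
  have "card (L - insert (a # w) K) = n"
    using Suc.hyps(2) v(1) fin unfolding aw by (simp add: Diff_insert[of L "a # w" K])
  moreover have "insert (a # w) K \<subseteq> L" using Suc.prems(3) v(1) aw by blast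
  moreover have "P (insert (a # w) K)"
    using grow[OF Suc.prems(1) wK, of a] Suc.prems(4) v(1) unfolding aw by blast
  ultimately show ?case using Suc.hyps(1)[OF _ sub Suc.prems(2)] by simp
qed

lemma subtree_root: "subtree {[]}"
  by (simp add: subtree_def Nil_in_W)

lemma \<Phi>_leaf:
  assumes "finite K" "a # w \<notin> K"
  shows "\<Phi> (insert (a # w) K) = \<Phi> K + edge_gain (fst a)"
  using assms by (simp add: tree_sum_def weight_def)

lemma word_entropy_root: "word_entropy {[]} = \<Phi> {[]}"
  by (simp add: word_entropy_def tree_sum_def weight_def)

lemma word_entropy_increment_le:
  assumes "subtree K" "subtree L" "K \<subseteq> L"
  shows "word_entropy L - word_entropy K \<le> \<Phi> L - \<Phi> K"
  using assms
proof (induction rule: subtree_grow_induct)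
  case base
  show ?case by simp
next
  case (grow N a w)
  have "word_entropy (insert (a # w) N) \<le> word_entropy N + edge_gain (fst a)"
    using grow assms(2) by (intro word_entropy_leaf_le) (auto simp: subtree_def)
  then show ?case using grow \<Phi>_leaf[of N a w] by (simp add: subtree_def)
qed

lemma word_entropy_le_\<Phi>: "subtree L \<Longrightarrow> word_entropy L \<le> \<Phi> L"
  using word_entropy_increment_le[OF subtree_root, of L] word_entropy_root by (simp add: subtree_def)

text \<open>Growing the smaller tree to the larger one gains at most the increment of \<open>\<Phi>\<close>, so a deficit on the
smaller tree would persist.\<close>

lemma additive_on_smaller_subtree:
  "subtree K \<Longrightarrow> subtree L \<Longrightarrow> K \<subseteq> L \<Longrightarrow> word_entropy L = \<Phi> L \<Longrightarrow> word_entropy K = \<Phi> K"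
  using word_entropy_increment_le[of K L] word_entropy_le_\<Phi>[of K] by linarith

lemma subtree_ball: "subtree (ball n)"
  unfolding subtree_def
  using finite_ball_words W_tail Nil_in_W by (auto simp: ball_words_def)

lemma finite_bud: "finite (bud n i)"
  by (rule finite_subset[OF _ finite_sphere[of r Sg "Suc n"]]) (auto simp: sphere_ending_def)

lemma subtree_ball_bud: "subtree (ball n \<union> bud n i)"
proof -
  have "w \<in> ball n" if "a # w \<in> bud n i" for a w
    using that W_tail[of a w] by (auto simp: sphere_ending_def word_sphere_def ball_words_def)
  moreover have "bud n i \<subseteq> W" by (auto simp: sphere_ending_def word_sphere_def)
  ultimately show ?thesis
    using subtree_ball[of n] finite_bud unfolding subtree_def by blast
qed

lemma \<Phi>_ball_bud: "\<Phi> (ball n \<union> bud n i) = \<Phi> (ball n) + \<Phi> (bud n i)"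
  unfolding tree_sum_def
proof (rule sum.union_disjoint[OF finite_ball_words finite_bud])
  show "ball n \<inter> bud n i = {}" by (auto simp: sphere_ending_def word_sphere_def ball_words_def)
qed

lemma subtree_subset_ball:
  assumes "subtree K"
  obtains n where "K \<subseteq> ball n"
proof
  have "length w \<le> Max (length ` K)" if "w \<in> K" for w
    using assms that by (intro Max_ge) (auto simp: subtree_def)
  then show "K \<subseteq> ball (Max (length ` K))"
    using assms by (auto simp: subtree_def ball_words_def)
qed

lemma tree_additiveI:
  assumes "\<And>n. word_entropy (ball n) = \<Phi> (ball n)"
  shows tree_additive
  unfolding tree_additive_def
proof (intro allI impI)
  fix K assume K: "subtree K"
  then obtain n where "K \<subseteq> ball n" by (rule subtree_subset_ball)
  then show "word_entropy K = \<Phi> K" using additive_on_smaller_subtree[OF K subtree_ball] assms by blast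
qed

subsection \<open>The Markov property and additivity\<close>

lemma Markov_iff_past_determined:
  "Markov_process G S T M \<alpha> \<longleftrightarrow> (\<forall>t\<in>S. \<forall>g\<in>carrier G. past_determined t g)"
  unfolding Markov_process_def Let_def
proof (intro ball_cong refl)
  fix t g assume t: "t \<in> S" and g: "g \<in> carrier G"
  have tg: "t \<otimes> g \<in> carrier G" using t g letter_closed by blast
  have sub: "Past G S (t \<otimes> g) g \<subseteq> carrier G" by (auto simp: Past_def)
  have "g \<in> set p" if "cayley_path G S g p (t \<otimes> g)" for p
    using that unfolding cayley_path_def by (metis hd_in_set)
  then have mem: "g \<in> Past G S (t \<otimes> g) g" using g by (simp add: Past_def)
  show "(\<forall>A\<in>\<alpha>. AE x in M.
      cond_prob_algebra M (T (t \<otimes> g) -` A \<inter> space M) (join_algebra T M \<alpha> (Past G S (t \<otimes> g) g)) x =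
      cond_prob_algebra M (T (t \<otimes> g) -` A \<inter> space M) (join_algebra T M \<alpha> {g}) x) \<longleftrightarrow> past_determined t g"
    unfolding past_determined_def by (rule cond_prob_eq_iff_entropy[OF sub mem tg])
qed

text \<open>A subtree to which \<open>a # w\<close> is attached as a leaf lies in the past of the edge from \<open>w\<close> to \<open>a # w\<close>, so
each leaf contributes its full weight.\<close>

lemma Markov_imp_tree_additive:
  assumes "Markov_process G S T M \<alpha>"
  shows tree_additive
  unfolding tree_additive_def
proof (intro allI impI)
  fix L assume L: "subtree L"
  then have "{[]} \<subseteq> L" by (simp add: subtree_def)
  with subtree_root L show "word_entropy L = \<Phi> L"
  proof (induction rule: subtree_grow_induct)
    case base
    show ?case by (rule word_entropy_root)
  next
    case (grow N a w)
    have N: "finite N" "N \<subseteq> W" and aw: "a # w \<in> W" using grow L by (auto simp: subtree_def)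
    have "\<not> suffix (a # w) v" if "v \<in> N" for v
    proof
      assume "suffix (a # w) v"
      then obtain u where "v = u @ a # w" by (auto simp: suffix_def)
      moreover have "u @ a # w \<in> N \<Longrightarrow> a # w \<in> N"
        using grow(1) by (induction u) (auto simp: subtree_def)
      ultimately show False using that grow(4) by blast
    qed
    then have "ev ` N \<subseteq> Past G S (ev (a # w)) (ev w)" unfolding Past_parent[OF aw] using N by blast
    moreover have "past_determined (letter G s a) (ev w)"
      using assms W_head[OF aw] ev_W_closed[OF W_tail[OF aw]] unfolding Markov_iff_past_determined by blast
    ultimately have "H (insert (ev (a # w)) (ev ` N)) + H {ev w} = H (ev ` N) + H {ev w, ev (a # w)}"
      unfolding past_determined_def ev_simps(2) using N grow(2) by blast
    then have "word_entropy (insert (a # w) N) = word_entropy N + edge_gain (fst a)"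
      using H_edge[OF aw] H_single[OF ev_W_closed[OF W_tail[OF aw]]] by (simp add: word_entropy_def)
    then show ?case using grow \<Phi>_leaf[of N a w] N by simp
  qed
qed

text \<open>A finite part \<open>K\<close> of the past extends to a subtree \<open>N\<close> in which the new vertex is still absent. Over
\<open>N\<close> it gains its full weight by additivity, and over the smaller set \<open>K\<close> it gains at least as much
as over \<open>N\<close>, but never more than the weight.\<close>

lemma tree_additive_imp_past_determined:
  assumes add: tree_additive and aw: "a # w \<in> W"
  shows "past_determined (letter G s a) (ev w)"
  unfolding past_determined_def
proof (intro allI impI)
  fix K' assume K': "finite K' \<and> K' \<subseteq> Past G S (letter G s a \<otimes> ev w) (ev w) \<and> ev w \<in> K'"
  define K where "K = {v \<in> W. ev v \<in> K'}"
  have wW: "w \<in> W" by (rule W_tail[OF aw])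
  have past: "K' \<subseteq> ev ` {v \<in> W. \<not> suffix (a # w) v}"
    using K' Past_parent[OF aw] by simp
  have evK: "ev ` K = K'"
  proof
    show "K' \<subseteq> ev ` K"
    proof
      fix g assume g: "g \<in> K'"
      then obtain v where "v \<in> W" "g = ev v" using past by blast
      then show "g \<in> ev ` K" using g unfolding K_def by simp
    qed
  qed (auto simp: K_def)
  have KW: "K \<subseteq> W" and wK: "w \<in> K" using K' wW by (auto simp: K_def)
  have "finite (ev ` K)" using K' evK by simp
  then have finK: "finite K" by (rule finite_imageD[OF _ inj_on_subset[OF inj_on_ev KW]])
  have nsuf: "\<not> suffix (a # w) v" if "v \<in> K" for v
  proof -
    have "ev v \<in> K'" using that by (simp add: K_def)
    then obtain v' where v': "v' \<in> W" "ev v = ev v'" "\<not> suffix (a # w) v'"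
      using past by blast
    have "v \<in> W" using that by (simp add: K_def)
    then have "v = v'" using v'(1,2) by (rule ev_inj)
    then show ?thesis using v'(3) by simp
  qed
  \<comment> \<open>closing under suffixes gives a subtree that still avoids the new vertex\<close>
  define N where "N = (\<Union>v\<in>K. {u. suffix u v})"
  have finN: "finite N" unfolding N_def
    using finK by (intro finite_UN_I) (simp_all flip: set_suffixes_eq)
  have NW: "N \<subseteq> W"
  proof
    fix u assume "u \<in> N"
    then obtain v where v: "v \<in> K" "suffix u v" unfolding N_def by blast
    then obtain x where "v = x @ u" unfolding suffix_def by blast
    then show "u \<in> W" using W_suffix[of x u] v(1) KW by blast
  qed
  have KN: "K \<subseteq> N" unfolding N_def using suffix_order.refl by blast
  have tail: "u \<in> N" if "b # u \<in> N" for b u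
    using that unfolding N_def by (blast intro: suffix_ConsD)
  have root: "[] \<in> N" using wK unfolding N_def by auto
  have subN: "subtree N" unfolding subtree_def using finN NW root tail by blast
  have awN: "a # w \<notin> N" using nsuf by (auto simp: N_def)
  have wN: "w \<in> N" using wK KN by blast
  have "subtree (insert (a # w) N)"
    using subN aw wN unfolding subtree_def by auto
  then have "word_entropy (insert (a # w) N) - word_entropy N = edge_gain (fst a)"
    using add subN \<Phi>_leaf[OF finN awN] unfolding tree_additive_def by simp
  moreover have "word_entropy (insert (a # w) K \<union> N) + word_entropy K \<le> word_entropy (insert (a # w) K) + word_entropy N"
    using finK finN KW NW KN aw by (intro word_entropy_submodular) auto
  moreover have "insert (a # w) K \<union> N = insert (a # w) N" using KN by blast
  moreover have "word_entropy (insert (a # w) K) \<le> word_entropy K + edge_gain (fst a)"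
    by (rule word_entropy_leaf_le[OF finK KW wK aw])
  ultimately have "word_entropy (insert (a # w) K) = word_entropy K + edge_gain (fst a)" by simp
  then show "H (insert (letter G s a \<otimes> ev w) K') + H {ev w} = H K' + H {ev w, letter G s a \<otimes> ev w}"
    using H_edge[OF aw] H_single[OF ev_W_closed[OF wW]] by (simp add: word_entropy_def evK)
qed

lemma cayley_path_translate:
  assumes g: "g \<in> carrier G" and p: "cayley_path G S f p f'"
  shows "cayley_path G S (f \<otimes> g) (map (\<lambda>k. k \<otimes> g) p) (f' \<otimes> g)"
proof -
  have edge: "left_cayley_edge G S (u \<otimes> g) (v \<otimes> g)" if "left_cayley_edge G S u v" for u v
    using that g letter_closed unfolding left_cayley_edge_def by (auto simp: m_assoc)
  have "successively (\<lambda>u v. left_cayley_edge G S u v \<or> left_cayley_edge G S v u) (map (\<lambda>k. k \<otimes> g) p)"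
    unfolding successively_map
    by (rule successively_mono[of "\<lambda>u v. left_cayley_edge G S u v \<or> left_cayley_edge G S v u"])
      (use p edge in \<open>auto simp: cayley_path_def\<close>)
  then show ?thesis using p g by (auto simp: cayley_path_def hd_map last_map)
qed

text \<open>In a group, right translation by \<open>g\<close> is an automorphism of the Cayley graph and preserves \<open>H\<close>.\<close>

lemma past_determined_translate:
  assumes "group G" and t: "t \<in> carrier G" and g: "g \<in> carrier G" and e: "past_determined t \<one>"
  shows "past_determined t g"
  unfolding past_determined_def
proof (intro allI impI)
  fix K assume K: "finite K \<and> K \<subseteq> Past G S (t \<otimes> g) g \<and> g \<in> K"
  interpret group G by fact
  let ?K = "(\<lambda>k. k \<otimes> inv g) ` K"
  have KG: "K \<subseteq> carrier G" using K by (auto simp: Past_def)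
  have undo: "(\<lambda>k. k \<otimes> g) ` ?K = K"
    using KG g by (force simp: image_image m_assoc)
  have K'G: "?K \<subseteq> carrier G" using KG g by auto
  have one: "\<one> \<in> ?K" using K g by (intro image_eqI[of _ _ g]) auto
  have "?K \<subseteq> Past G S t \<one>"
  proof
    fix k assume k: "k \<in> ?K"
    have "\<one> \<in> set p" if p: "cayley_path G S k p t" for p
    proof -
      have "k \<otimes> g \<in> Past G S (t \<otimes> g) g" using k undo K by blast
      moreover have "cayley_path G S (k \<otimes> g) (map (\<lambda>k. k \<otimes> g) p) (t \<otimes> g)"
        by (rule cayley_path_translate[OF g p])
      ultimately have "g \<in> set (map (\<lambda>k. k \<otimes> g) p)" unfolding Past_def by blast
      then obtain u where u: "u \<in> set p" "g = u \<otimes> g" by auto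
      then have "u \<in> carrier G" using p by (auto simp: cayley_path_def)
      then show ?thesis using u g by simp
    qed
    then show "k \<in> Past G S t \<one>" using k K'G by (auto simp: Past_def)
  qed
  then have e': "H (insert t ?K) + H {\<one>} = H ?K + H {\<one>, t}"
    using e K one t unfolding past_determined_def by simp
  have "H (insert (t \<otimes> g) K) = H (insert t ?K)"
    using H_translate[OF g, of "insert t ?K"] K t K'G unfolding image_insert undo by simp
  moreover have "H K = H ?K" using H_translate[OF g, of ?K] K K'G unfolding undo by simp
  moreover have "H {g, t \<otimes> g} = H {\<one>, t}" using H_translate[OF g, of "{\<one>, t}"] t g by simp
  ultimately show "H (insert (t \<otimes> g) K) + H {g} = H K + H {g, t \<otimes> g}"
    using e' H_single[OF g] by simp
qed

text \<open>Edges leading to a child are treated directly. An edge leading to the parent of \<open>g\<close> requires inverse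
letters, hence a group, and is a translate of an edge at the identity, which leads to a child.\<close>

lemma Markov_iff_tree_additive:
  assumes grp: "Sg = UNIV \<Longrightarrow> group G"
  shows "Markov_process G S T M \<alpha> \<longleftrightarrow> tree_additive"
proof
  assume add: tree_additive
  show "Markov_process G S T M \<alpha>"
    unfolding Markov_iff_past_determined
  proof (intro ballI)
    fix t g assume "t \<in> S" and g: "g \<in> carrier G"
    then obtain a where a: "a \<in> \<Lambda>" "t = letter G s a" by blast
    obtain w where w: "w \<in> W" "ev w = g" using ev_surj[OF g] by blast
    show "past_determined t g"
    proof (cases "a # w \<in> W")
      case True
      then show ?thesis using tree_additive_imp_past_determined[OF add True] a w by simp
    next
      case False
      then obtain v where "w = inv_letter a # v" using letter_step[OF w(1) a(1)] by blast
      then have "inv_letter a \<in> \<Lambda>" using W_head w(1) by blast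
      then have "Sg = UNIV" using a(1) signs by (auto simp: letters_def inv_letter_def)
      then have "group G" by (rule grp)
      have "[a] \<in> W" using a by (simp add: red_words_def reduced_simps)
      then have "past_determined t \<one>"
        using tree_additive_imp_past_determined[OF add, of a "[]"] a by simp
      then show ?thesis
        using past_determined_translate[OF \<open>group G\<close> _ g] a letter_closed by blast
    qed
  qed
qed (rule Markov_imp_tree_additive)

subsection \<open>The functional F on balls\<close>

definition F_ball :: "nat \<Rightarrow> real" where
  "F_ball n = (1 - 2 * real r) * word_entropy (ball n) + (\<Sum>i<r. word_entropy (ball n \<union> bud n i))"

definition F_zero :: real where
  "F_zero = (1 - real r) * H {\<one>} + (\<Sum>i<r. edge_gain i)"

lemma \<Phi>_ball_identity: "(1 - real r) * \<Phi> (ball n) + (\<Sum>i<r. \<Phi> (bud n i)) = F_zero"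
  unfolding F_zero_def by (rule tree_sum_identity[OF signs])

lemma \<Phi>_ball_Suc: "\<Phi> (ball (Suc n)) = \<Phi> (ball n) + real (card Sg) * (\<Sum>i<r. \<Phi> (bud n i))"
  by (simp only: tree_sum_ball_Suc tree_sum_sphere_ending[OF signs])

lemma F_ball_additive:
  assumes tree_additive
  shows "F_ball n = F_zero"
proof -
  have "word_entropy (ball n) = \<Phi> (ball n)" "word_entropy (ball n \<union> bud n i) = \<Phi> (ball n) + \<Phi> (bud n i)" for i
    using assms subtree_ball subtree_ball_bud \<Phi>_ball_bud unfolding tree_additive_def by metis+
  then have "F_ball n = (1 - real r) * \<Phi> (ball n) + (\<Sum>i<r. \<Phi> (bud n i))"
    by (simp add: F_ball_def sum.distrib algebra_simps)
  then show ?thesis by (simp add: \<Phi>_ball_identity)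
qed

text \<open>Strong subadditivity for a ball and its translate, which have the same entropy. The set \<open>C\<close> is left
open because the two overlap differently in groups and in semigroups.\<close>

lemma H_ball_Un_translate_le:
  assumes i: "i < r" and C: "C \<subseteq> ev ` ball n" "C \<subseteq> (\<lambda>k. k \<otimes> s i) ` ev ` ball n"
  shows "word_entropy (ball n \<union> bud n i) + H C \<le> 2 * word_entropy (ball n)"
proof -
  let ?X = "ev ` ball n"
  have X: "finite ?X" "?X \<subseteq> carrier G"
    using subtree_ball[of n] ev_image_closed by (auto simp: subtree_def)
  have "word_entropy (ball n \<union> bud n i) = H (?X \<union> (\<lambda>k. k \<otimes> s i) ` ?X)"
    using ball_Un_translate[OF letter_plus(1)[OF i], of n] by (simp add: word_entropy_def letter_plus(2))
  moreover have "H ((\<lambda>k. k \<otimes> s i) ` ?X) = word_entropy (ball n)"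
    using H_translate[OF s_closed[OF i] X] by (simp add: word_entropy_def)
  moreover have "H (?X \<union> (\<lambda>k. k \<otimes> s i) ` ?X) + H C \<le> H ?X + H ((\<lambda>k. k \<otimes> s i) ` ?X)"
    using X C s_closed[OF i] by (intro H_submodular) auto
  ultimately show ?thesis by (simp add: word_entropy_def)
qed

lemma ball_mono: "ball n \<subseteq> ball (Suc n)"
  by (auto simp: ball_words_def)

text \<open>The inductive step of the converse. In a group the overlap of the larger ball with its translate
contains the smaller ball together with its own translate; in a semigroup it is guaranteed to contain
only the translate of the smaller ball. Either overlap turns \<open>F_zero \<le> F_ball (n + 1)\<close> into a lower
bound for the entropy of the larger ball, and with the counting identities this bound is \<open>\<Phi>\<close>. The
group case uses \<open>F_zero \<le> F_ball n\<close> in addition, to bound the entropy of the overlap from below.\<close>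

lemma ball_additive_Suc:
  assumes F: "\<And>n. F_zero \<le> F_ball n" and IH: "word_entropy (ball n) = \<Phi> (ball n)"
  shows "word_entropy (ball (Suc n)) = \<Phi> (ball (Suc n))"
proof -
  let ?B = "ball (Suc n)"
  have trans: "(\<lambda>k. k \<otimes> s i) ` ev ` ball n \<subseteq> ev ` ?B" "(\<lambda>k. k \<otimes> s i) ` ev ` ball n \<subseteq> (\<lambda>k. k \<otimes> s i) ` ev ` ?B"
    if i: "i < r" for i
    using ball_translate_subset[OF letter_plus(1)[OF i], of n] ball_mono[of n] by (auto simp: letter_plus(2))
  have "\<Phi> ?B \<le> word_entropy ?B"
    using signs
  proof
    assume Sg: "Sg = UNIV"
    have "word_entropy (?B \<union> bud (Suc n) i) \<le> 2 * word_entropy ?B - word_entropy (ball n \<union> bud n i)" if i: "i < r" for i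
    proof -
      have a: "(i, False) \<in> \<Lambda>" using i Sg by (simp add: letters_def)
      let ?C = "ev ` ball n \<union> (\<lambda>k. k \<otimes> s i) ` ev ` ball n"
      have "ev ` ball n \<subseteq> (\<lambda>k. k \<otimes> s i) ` ev ` ?B"
      proof
        fix g assume g: "g \<in> ev ` ball n"
        have gG: "g \<in> carrier G" using g ev_W_closed by (auto simp: ball_words_def)
        have "letter G s (i, False) \<otimes> s i = \<one>"
          using letter_inv_letter[OF a] letter_plus(1)[OF i] by (simp add: letter_plus(2))
        then have "g = (g \<otimes> letter G s (i, False)) \<otimes> s i"
          using gG letter_closed[OF a] s_closed[OF i] by (simp add: m_assoc)
        \<comment> \<open>translating back by the inverse generator stays in the larger ball\<close>
        moreover have "g \<otimes> letter G s (i, False) \<in> ev ` ?B"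
          using ball_translate_subset[OF a, of n] g by blast
        ultimately show "g \<in> (\<lambda>k. k \<otimes> s i) ` ev ` ?B" by blast
      qed
      then have "?C \<subseteq> ev ` ?B" "?C \<subseteq> (\<lambda>k. k \<otimes> s i) ` ev ` ?B"
        using trans[OF i] ball_mono[of n] by blast+
      from H_ball_Un_translate_le[OF i this]
      show ?thesis
        using ball_Un_translate[OF letter_plus(1)[OF i], of n] by (simp add: word_entropy_def letter_plus(2))
    qed
    then have "(\<Sum>i<r. word_entropy (?B \<union> bud (Suc n) i)) \<le> (\<Sum>i<r. 2 * word_entropy ?B - word_entropy (ball n \<union> bud n i))"
      by (intro sum_mono) simp
    then have "F_ball (Suc n) \<le> word_entropy ?B - (\<Sum>i<r. word_entropy (ball n \<union> bud n i))"
      by (simp add: F_ball_def sum_subtractf algebra_simps)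
    moreover have "(\<Sum>i<r. word_entropy (ball n \<union> bud n i)) = F_ball n - (1 - 2 * real r) * \<Phi> (ball n)"
      by (simp add: F_ball_def IH)
    ultimately have "2 * F_zero - (1 - 2 * real r) * \<Phi> (ball n) \<le> word_entropy ?B"
      using F[of n] F[of "Suc n"] by linarith
    moreover have "\<Phi> ?B = \<Phi> (ball n) + 2 * (\<Sum>i<r. \<Phi> (bud n i))"
      unfolding \<Phi>_ball_Suc by (simp add: Sg card_UNIV_bool)
    ultimately show ?thesis
      using \<Phi>_ball_identity[of n] by (simp add: algebra_simps)
  next
    assume Sg: "Sg = {True}"
    have "word_entropy (?B \<union> bud (Suc n) i) \<le> 2 * word_entropy ?B - \<Phi> (ball n)" if i: "i < r" for i
    proof -
      have "H ((\<lambda>k. k \<otimes> s i) ` ev ` ball n) = word_entropy (ball n)"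
        unfolding word_entropy_def using subtree_ball[of n] ev_image_closed s_closed[OF i]
        by (intro H_translate) (auto simp: subtree_def)
      then show ?thesis using H_ball_Un_translate_le[OF i trans[OF i]] IH by simp
    qed
    then have "(\<Sum>i<r. word_entropy (?B \<union> bud (Suc n) i)) \<le> (\<Sum>i<r. 2 * word_entropy ?B - \<Phi> (ball n))"
      by (intro sum_mono) simp
    then have "F_ball (Suc n) \<le> word_entropy ?B - real r * \<Phi> (ball n)"
      by (simp add: F_ball_def algebra_simps)
    moreover have "\<Phi> ?B = \<Phi> (ball n) + (\<Sum>i<r. \<Phi> (bud n i))"
      unfolding \<Phi>_ball_Suc by (simp add: Sg)
    ultimately show ?thesis
      using F[of "Suc n"] \<Phi>_ball_identity[of n] by (simp add: algebra_simps)
  qed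
  then show ?thesis using word_entropy_le_\<Phi>[OF subtree_ball, of "Suc n"] by simp
qed

lemma tree_additive_iff_F_ball: "tree_additive \<longleftrightarrow> (\<forall>n. F_zero \<le> F_ball n)"
proof
  assume F: "\<forall>n. F_zero \<le> F_ball n"
  show tree_additive
  proof (rule tree_additiveI)
    show "word_entropy (ball n) = \<Phi> (ball n)" for n
    proof (induction n)
      case 0
      show ?case by (simp only: ball_words_0 word_entropy_root)
    next
      case (Suc n)
      show ?case by (rule ball_additive_Suc[OF _ Suc]) (simp add: F)
    qed
  qed
qed (simp add: F_ball_additive)

subsection \<open>Identification with the invariants\<close>

lemma F_functional_join:
  assumes K: "finite K" "K \<subseteq> carrier G" "K \<noteq> {}"
  shows "F_functional r s T M (common_refinement ((\<lambda>g. pullback M (T g) \<alpha>) ` K)) =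
    ereal ((1 - 2 * real r) * H K + (\<Sum>i<r. H (K \<union> (\<lambda>k. k \<otimes> s i) ` K)))"
proof -
  have "(\<Sum>i<r. enn2ereal (partition_entropy M (common_refinement
      {common_refinement ((\<lambda>g. pullback M (T g) \<alpha>) ` K),
       pullback M (T (s i)) (common_refinement ((\<lambda>g. pullback M (T g) \<alpha>) ` K))}))) =
      (\<Sum>i<r. ereal (H (K \<union> (\<lambda>k. k \<otimes> s i) ` K)))"
    using partition_entropy_join(2)[OF K] s_closed H_nonneg by (intro sum.cong) simp_all
  then show ?thesis
    using partition_entropy_join(1)[OF K] H_nonneg[of K]
    by (simp add: F_functional_def sum_ereal)
qed

lemma F_functional_partition: "F_functional r s T M \<alpha> = ereal F_zero"
proof -
  have "(\<lambda>k. k \<otimes> s i) ` {\<one>} = {s i}" if "i < r" for i using s_closed[OF that] by simp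
  then have "(\<Sum>i<r. H ({\<one>} \<union> (\<lambda>k. k \<otimes> s i) ` {\<one>})) = (\<Sum>i<r. edge_gain i + H {\<one>})"
    by (intro sum.cong) (simp_all add: edge_gain_def insert_commute)
  then show ?thesis
    using F_functional_join[of "{\<one>}"] unfolding join_one
    by (simp add: F_zero_def sum.distrib algebra_simps)
qed

lemma F_functional_ball_join: "F_functional r s T M (ball_join G S T M \<alpha> n) = ereal (F_ball n)"
proof -
  have K: "finite (ev ` ball n)" "ev ` ball n \<subseteq> carrier G" "ev ` ball n \<noteq> {}"
    using subtree_ball[of n] ev_image_closed by (auto simp: subtree_def)
  have "(\<Sum>i<r. H (ev ` ball n \<union> (\<lambda>k. k \<otimes> s i) ` ev ` ball n)) = (\<Sum>i<r. word_entropy (ball n \<union> bud n i))"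
    using ball_Un_translate[OF letter_plus(1), of _ n] by (intro sum.cong) (simp_all add: word_entropy_def letter_plus(2))
  then show ?thesis
    unfolding ball_join_def word_ball_eq F_functional_join[OF K] by (simp add: F_ball_def word_entropy_def)
qed

text \<open>The infimum defining \<open>f\<close> runs over positive radii, while the additivity criterion includes radius
\<open>0\<close>; there \<open>F\<close> takes the value \<open>F_zero\<close> because the join over the ball of radius \<open>0\<close> is \<open>\<alpha>\<close>.\<close>

lemma Markov_iff_F_eq_f:
  assumes grp: "Sg = UNIV \<Longrightarrow> group G"
  shows "Markov_process G S T M \<alpha> \<longleftrightarrow> F_functional r s T M \<alpha> = f_invariant G r s S T M \<alpha>"
proof -
  have inf: "f_invariant G r s S T M \<alpha> = (INF n\<in>{0<..}. ereal (F_ball n))"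
    by (simp add: f_invariant_def F_functional_ball_join)
  have "F_ball 0 = F_zero"
  proof -
    have "ereal (F_ball 0) = F_functional r s T M (ball_join G S T M \<alpha> 0)"
      by (rule F_functional_ball_join[symmetric])
    also have "ball_join G S T M \<alpha> 0 = \<alpha>"
      unfolding ball_join_def word_ball_eq ball_words_0 using join_one by simp
    finally show ?thesis by (simp add: F_functional_partition)
  qed
  have "tree_additive \<longleftrightarrow> ereal F_zero = (INF n\<in>{0<..}. ereal (F_ball n))"
  proof
    assume tree_additive
    then show "ereal F_zero = (INF n\<in>{0<..}. ereal (F_ball n))"
      by (simp add: F_ball_additive)
  next
    assume eq: "ereal F_zero = (INF n\<in>{0<..}. ereal (F_ball n))"
    have "F_zero \<le> F_ball n" for n
    proof (cases "n = 0")
      case False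
      then have "ereal F_zero \<le> ereal (F_ball n)" unfolding eq by (intro INF_lower) simp
      then show ?thesis by simp
    qed (simp add: \<open>F_ball 0 = F_zero\<close>)
    then show tree_additive by (simp add: tree_additive_iff_F_ball)
  qed
  moreover have "Markov_process G S T M \<alpha> \<longleftrightarrow> tree_additive"
    by (rule Markov_iff_tree_additive) (rule grp)
  ultimately show ?thesis unfolding F_functional_partition inf by (simp only:)
qed

end

theorem theorem11p1:
  fixes G :: "('g, 'b) monoid_scheme" and r :: nat and s :: "nat \<Rightarrow> 'g" and S :: "'g set"
    and T :: "'g \<Rightarrow> 'x \<Rightarrow> 'x" and M :: "'x measure" and \<alpha> :: "'x set set"
  assumes free: "(free_group_on G r s \<and> S = s ` {..<r} \<union> (\<lambda>i. inv\<^bsub>G\<^esub> (s i)) ` {..<r}) \<or>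
                 (free_semigroup_on G r s \<and> S = s ` {..<r})"
    and process: "G_process G T M \<alpha>"
    and finite_entropy: "partition_entropy M \<alpha> < \<infinity>"
  shows "Markov_process G S T M \<alpha> \<longleftrightarrow> F_functional r s T M \<alpha> = f_invariant G r s S T M \<alpha>"
proof -
  obtain Sg where tree: "word_tree G r s Sg" and S: "S = letter G s ` letters r Sg"
    and grp: "Sg = UNIV \<Longrightarrow> group G"
    using free
  proof
    assume *: "free_group_on G r s \<and> S = s ` {..<r} \<union> (\<lambda>i. inv\<^bsub>G\<^esub> (s i)) ` {..<r}"
    have "letter G s ` letters r UNIV = s ` {..<r} \<union> (\<lambda>i. inv\<^bsub>G\<^esub> (s i)) ` {..<r}"
    proof -
      have "letters r UNIV = (\<lambda>i. (i, True)) ` {..<r} \<union> (\<lambda>i. (i, False)) ` {..<r}"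
        unfolding letters_def UNIV_bool by auto
      then show ?thesis by (simp only: image_Un image_image letter_def snd_conv fst_conv if_True if_False)
    qed
    then show ?thesis
      using * that[of UNIV] free_group_word_tree[of G r s] by (simp add: free_group_on_def)
  next
    assume *: "free_semigroup_on G r s \<and> S = s ` {..<r}"
    have "letter G s ` letters r {True} = s ` {..<r}"
    proof -
      have "letters r {True} = (\<lambda>i. (i, True)) ` {..<r}" unfolding letters_def by auto
      then show ?thesis by (simp only: image_image letter_def snd_conv fst_conv if_True)
    qed
    moreover have "{True} \<noteq> UNIV" by auto
    ultimately show ?thesis
      using * that[of "{True}"] free_semigroup_word_tree[of G r s] by simp
  qed
  interpret word_tree G r s Sg by (rule tree)
  have action: "pmp_action G M T" and "partition_on (space M) \<alpha>" "\<alpha> \<subseteq> sets M" "countable \<alpha>"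
    using process by (auto simp: G_process_def)
  moreover have "prob_space M" using action by (simp add: pmp_action_def standard_prob_space_def)
  ultimately interpret labelled_tree G T M \<alpha> r s Sg
    using finite_entropy
    by (intro labelled_tree.intro labelled_action.intro labelled_action_axioms.intro word_tree_axioms monoid_axioms)
      (auto simp: pmp_action_def)
  show ?thesis unfolding S by (rule Markov_iff_F_eq_f) (rule grp)
qed

end
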